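(* Let $R\in\mathbb N^p$, $C\in\mathbb N^q$, let $\mathbf A,\mathbf A'\in\mathcal M(R,C)$ and let $\mathbf M=\mathbf A'-\mathbf A$. Suppose: (i) there exists $\mathbf T=(t_{ik})\in\mathcal M_{p-1,q-1}(\mathbb N)$ with $\mathbf M=\sum_{i=1}^{p-1}\sum_{k=1}^{q-1}t_{ik}\,\mathbf C_{i,i+1,k,k+1}$; (ii) for every integer $s\ge1$, each connected component of $\mathcal P_s(\mathbf M)$ is simply connected; (iii) for all cells $(i,k),(i',k')$ of the grid with $|i'-i|\le1$ and $|k'-k|\le1$, one has $|t_{i'k'}-t_{ik}|\le1$. Then $\mathbf A'$ can be reached from $\mathbf A$ by a finite sequence of positive switches (i.e. there is a directed path from $\mathbf A$ to $\mathbf A'$ in $G(R,C)$).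
   Context: $\mathcal M(R,C)$ denotes the set of $p\times q$ $(0,1)$-matrices with row sums $R$ and column sums $C$. A checkerboard is a $2\times2$ submatrix on rows $i<j$ and columns $k<l$; positive if equal to $\begin{pmatrix}1&0\\0&1\end{pmatrix}$, negative if equal to $\begin{pmatrix}0&1\\1&0\end{pmatrix}$. A positive switch replaces a negative checkerboard by the positive one. $G(R,C)$ is the directed graph on $\mathcal M(R,C)$ with an arc $\mathbf A\to\mathbf A'$ when $\mathbf A'$ is obtained from $\mathbf A$ by one positive switch. For $i<j$, $k<l$, $\mathbf C_{i,j,k,l}$ is the $p\times q$ matrix with entries $+1$ at $(i,k)$ and $(j,l)$, $-1$ at $(i,l)$ and $(j,k)$, and $0$ elsewhere. Consider a grid of $(p-1)\times(q-1)$ closed unit square cells in the plane, cell $(i,k)$ carrying the value $t_{ik}$. For $s\ge1$, $\mathcal P_s(\mathbf M)$ is the union of the cells $(i,k)$ with $t_{ik}\ge s$; its connected components are taken with respect to cells sharing an edge, each component being regarded as a planar region (a polyomino), and simply connected means the region has no holes. *)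

theory Defs
  imports
    "HOL-Analysis.Homotopy"
    "Jordan_Normal_Form.Matrix"
    "Graph_Theory.Pair_Digraph"
begin

text \<open>Rows, columns and grid cells are indexed from 0.\<close>

definition matrix_class :: "nat Matrix.vec \<Rightarrow> nat Matrix.vec \<Rightarrow> int Matrix.mat set" where
  "matrix_class R C =
    {A \<in> carrier_mat (dim_vec R) (dim_vec C).
      elements_mat A \<subseteq> {0, 1} \<and>
      (\<forall>i < dim_vec R. (\<Sum>k < dim_vec C. A $$ (i, k)) = int (vec_index R i)) \<and>
      (\<forall>k < dim_vec C. (\<Sum>i < dim_vec R. A $$ (i, k)) = int (vec_index C k))}"

definition positive_checkerboard ::
    "int Matrix.mat \<Rightarrow> nat \<Rightarrow> nat \<Rightarrow> nat \<Rightarrow> nat \<Rightarrow> bool" where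
  "positive_checkerboard A i j k l \<longleftrightarrow>
    i < j \<and> j < dim_row A \<and> k < l \<and> l < dim_col A \<and>
    A $$ (i, k) = 1 \<and> A $$ (i, l) = 0 \<and>
    A $$ (j, k) = 0 \<and> A $$ (j, l) = 1"

definition negative_checkerboard ::
    "int Matrix.mat \<Rightarrow> nat \<Rightarrow> nat \<Rightarrow> nat \<Rightarrow> nat \<Rightarrow> bool" where
  "negative_checkerboard A i j k l \<longleftrightarrow>
    i < j \<and> j < dim_row A \<and> k < l \<and> l < dim_col A \<and>
    A $$ (i, k) = 0 \<and> A $$ (i, l) = 1 \<and>
    A $$ (j, k) = 1 \<and> A $$ (j, l) = 0"

definition positive_switch :: "int Matrix.mat \<Rightarrow> int Matrix.mat \<Rightarrow> bool" where
  "positive_switch A A' \<longleftrightarrow>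
    dim_row A' = dim_row A \<and> dim_col A' = dim_col A \<and>
    (\<exists>i j k l. negative_checkerboard A i j k l \<and> positive_checkerboard A' i j k l \<and>
      (\<forall>a < dim_row A. \<forall>b < dim_col A.
        (a, b) \<notin> {i, j} \<times> {k, l} \<longrightarrow> A' $$ (a, b) = A $$ (a, b)))"

definition switch_digraph ::
    "nat Matrix.vec \<Rightarrow> nat Matrix.vec \<Rightarrow> int Matrix.mat pair_pre_digraph" where
  "switch_digraph R C =
    \<lparr> pverts = matrix_class R C,
      parcs = {(A, A'). A \<in> matrix_class R C \<and> A' \<in> matrix_class R C \<and> positive_switch A A'} \<rparr>"

definition checkerboard_mat ::
    "nat \<Rightarrow> nat \<Rightarrow> nat \<Rightarrow> nat \<Rightarrow> nat \<Rightarrow> nat \<Rightarrow> int Matrix.mat" where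
  "checkerboard_mat p q i j k l =
    Matrix.mat p q (\<lambda>ab.
      if ab \<in> {(i, k), (j, l)} then 1
      else if ab \<in> {(i, l), (j, k)} then - 1
      else 0)"

definition level_cells :: "nat Matrix.mat \<Rightarrow> nat \<Rightarrow> (nat \<times> nat) set" where
  "level_cells T s = {(i, k). i < dim_row T \<and> k < dim_col T \<and> s \<le> T $$ (i, k)}"

definition share_edge :: "nat \<times> nat \<Rightarrow> nat \<times> nat \<Rightarrow> bool" where
  "share_edge c d \<longleftrightarrow>
    fst c = fst d \<and> (snd d = Suc (snd c) \<or> snd c = Suc (snd d)) \<or>
    snd c = snd d \<and> (fst d = Suc (fst c) \<or> fst c = Suc (fst d))"

definition edge_components :: "(nat \<times> nat) set \<Rightarrow> (nat \<times> nat) set set" where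
  "edge_components S = S // {(c, d). c \<in> S \<and> d \<in> S \<and> share_edge c d}\<^sup>*"

text \<open>
  The plane is \<open>\<complex>\<close>. The column index gives the real part and the row index the imaginary part;
  the grid is thus drawn upside down, which does not affect simple connectedness.
\<close>

definition cell_region :: "nat \<times> nat \<Rightarrow> complex set" where
  "cell_region c =
    cbox (Complex (real (snd c)) (real (fst c))) (Complex (real (snd c) + 1) (real (fst c) + 1))"

text \<open>
  The squares are closed, so two cells of the same component that meet only in a corner are
  joined there, and can enclose a hole.
\<close>

definition polyomino_region :: "(nat \<times> nat) set \<Rightarrow> complex set" where
  "polyomino_region D = (\<Union>c\<in>D. cell_region c)"

end

(*
  The matrix M is the corner sum of the potential T. Around an inner entry T takes at most two
  consecutive values by (iii), so at most one superlevel set of T contributes to that entry, and at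
  the border of the grid the bound |M| <= 1 gives the same. The levels can therefore be switched one after the other with all intermediate matrices (0,1). One level is a
  polyomino D without holes. Cut into maximal row runs, it becomes a forest, in which every
  contact between two runs of consecutive rows separates D. A contact with a reflex corner at
  an end splits D into two parts, one of which can be switched first without leaving the (0,1)
  matrices. When no such contact is left, the components are rectangles, and switching a rectangle
  is a single positive switch.
  That contacts separate D comes from a map to the circle that winds once across the contact: on
  the simply connected region it has a logarithm, whose branch jumps exactly at the contact.
*)
theory Submission
  imports Defs "HOL-Analysis.Further_Topology"
begin

section \<open>Integer phases on a simply connected union of convex sets\<close>

text \<open>Supplies the local path connectedness needed to lift a circle-valued map. After
  splitting off one set \<open>S\<close>, both the rest and its overlap with \<open>S\<close> are
  unions of fewer closed convex sets, so the induction covers both.\<close>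

lemma ENR_Union_convex_closed:
  fixes F :: "'a::euclidean_space set set"
  assumes "finite F" and "\<And>S. S \<in> F \<Longrightarrow> closed S \<and> convex S"
  shows "ENR (\<Union>F)"
  using assms
proof (induction "card F" arbitrary: F rule: less_induct)
  case less
  show ?case
  proof (cases "F = {}")
    case True
    then show ?thesis by (simp add: ENR_empty)
  next
    case False
    then obtain S where S: "S \<in> F" by blast
    define G where "G = F - {S}"
    have fin: "finite G" and lt: "card G < card F" and F: "\<Union>F = S \<union> \<Union>G"
      using S less.prems(1) card_Diff1_less[of F S] by (auto simp: G_def)
    have "card ((\<inter>) S ` G) < card F"
      using card_image_le[OF fin] lt le_less_trans by blast
    then have "ENR (\<Union>((\<inter>) S ` G))"
      by (rule less.hyps) (use fin S less.prems(2) in \<open>auto simp: G_def convex_Int closed_Int\<close>)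
    then have int: "ENR (S \<inter> \<Union>G)" by (simp only: Int_Union)
    have "ENR (\<Union>G)"
      by (rule less.hyps[OF lt fin]) (use less.prems(2) in \<open>auto simp: G_def\<close>)
    moreover have "ENR S" "closed S" "closed (\<Union>G)"
      using S fin less.prems(2) by (auto simp: G_def ENR_convex_closed intro!: closed_Union)
    ultimately show ?thesis
      unfolding F using int by (intro ENR_closed_Un)
  qed
qed

text \<open>Distinct integers are at distance at least 1, so a continuous integer-valued function
  cannot jump on a connected set.\<close>

lemma integer_valued_constant:
  fixes r :: "'a::topological_space \<Rightarrow> real"
  assumes "connected S" "continuous_on S r" "\<And>z. z \<in> S \<Longrightarrow> r z \<in> \<int>"
  obtains n :: int where "\<And>z. z \<in> S \<Longrightarrow> r z = n"
proof -
  have "r constant_on S"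
  proof (rule continuous_discrete_range_constant[OF assms(1,2)])
    fix x assume x: "x \<in> S"
    have "1 \<le> norm (r y - r x)" if y: "y \<in> S \<and> r y \<noteq> r x" for y
    proof -
      obtain m n :: int where mn: "r x = m" "r y = n"
        using assms(3)[OF x] assms(3)[of y] y by (auto elim!: Ints_cases)
      then have "1 \<le> \<bar>n - m\<bar>" using y by auto
      then have "(1::real) \<le> of_int \<bar>n - m\<bar>" by linarith
      then show ?thesis using mn by simp
    qed
    then show "\<exists>e>0. \<forall>y. y \<in> S \<and> r y \<noteq> r x \<longrightarrow> e \<le> norm (r y - r x)"
      by (intro exI[of _ 1]) auto
  qed
  then obtain c where c: "\<And>z. z \<in> S \<Longrightarrow> r z = c"
    by (auto simp: constant_on_def)
  show thesis
  proof (cases "S = {}")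
    case True then show ?thesis using that by auto
  next
    case False
    then obtain z where "z \<in> S" by blast
    then obtain n :: int where "c = n"
      using assms(3) c by (metis Ints_cases)
    then show ?thesis using that c by auto
  qed
qed

text \<open>
  The local phases \<open>\<phi> c\<close> glue to a map \<open>exp (2 \<pi> \<i> \<phi>)\<close> into the circle, whose logarithm on the
  simply connected union differs from each \<open>\<phi> c\<close> by an integer.
\<close>

lemma simply_connected_phase_lift:
  fixes \<phi> :: "'c \<Rightarrow> 'a::euclidean_space \<Rightarrow> real" and K :: "'c \<Rightarrow> 'a set"
  assumes fin: "finite D"
    and K: "\<And>c. c \<in> D \<Longrightarrow> closed (K c) \<and> convex (K c)"
    and sc: "simply_connected (\<Union>c\<in>D. K c)"
    and cont: "\<And>c. c \<in> D \<Longrightarrow> continuous_on (K c) (\<phi> c)"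
    and int: "\<And>c d z. c \<in> D \<Longrightarrow> d \<in> D \<Longrightarrow> z \<in> K c \<Longrightarrow> z \<in> K d \<Longrightarrow> \<phi> c z - \<phi> d z \<in> \<int>"
  obtains h :: "'c \<Rightarrow> int" where
    "\<And>c d z. c \<in> D \<Longrightarrow> d \<in> D \<Longrightarrow> z \<in> K c \<Longrightarrow> z \<in> K d \<Longrightarrow> \<phi> c z + h c = \<phi> d z + h d"
proof -
  define S where "S = (\<Union>c\<in>D. K c)"
  define e where "e c z = exp (2 * pi * \<phi> c z * \<i>)" for c z
  have KS: "K c \<subseteq> S" if "c \<in> D" for c using that by (auto simp: S_def)
  \<comment> \<open>The sets \<open>K c\<close> form a finite closed cover, and phases that differ
    by integers have equal exponentials, so the local maps glue.\<close>
  obtain f where f: "continuous_map (top_of_set S) euclidean f"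
    and fe: "\<And>z c. c \<in> D \<Longrightarrow> z \<in> topspace (top_of_set S) \<inter> K c \<Longrightarrow> f z = e c z"
  proof (rule pasting_lemma_exists_closed[OF fin, of "top_of_set S" K euclidean e])
    show "topspace (top_of_set S) \<subseteq> \<Union>(K ` D)" by (simp add: S_def)
    show "closedin (top_of_set S) (K c)" if "c \<in> D" for c
      using that K KS by (auto intro: closed_subset)
    show "continuous_map (subtopology (top_of_set S) (K c)) euclidean (e c)" if "c \<in> D" for c
    proof -
      have "continuous_on (K c) (e c)"
        unfolding e_def by (intro continuous_intros cont that)
      then show ?thesis using KS[OF that]
        by (simp add: subtopology_subtopology Int_absorb1)
    qed
    show "e c z = e d z" if cd: "c \<in> D" "d \<in> D" "z \<in> topspace (top_of_set S) \<inter> K c \<inter> K d" for c d z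
    proof -
      obtain n :: int where "\<phi> c z - \<phi> d z = n"
        using int[OF cd(1,2), of z] cd(3) by (auto elim: Ints_cases)
      then have "\<phi> c z = \<phi> d z + n" by simp
      then show ?thesis unfolding e_def exp_eq
        by (intro exI[of _ n]) (simp add: algebra_simps)
    qed
  qed auto
  have "locally path_connected S"
    unfolding S_def by (intro ENR_imp_locally_path_connected ENR_Union_convex_closed) (use fin K in auto)
  moreover have "continuous_on S f" using f by simp
  moreover have "f z \<noteq> 0" if "z \<in> S" for z
  proof -
    from that obtain c where "c \<in> D" "z \<in> K c" by (auto simp: S_def)
    then show ?thesis using fe[of c z] that by (simp add: e_def)
  qed
  ultimately obtain g where g: "continuous_on S g" "\<And>z. z \<in> S \<Longrightarrow> f z = exp (g z)"
    using continuous_logarithm_on_simply_connected[of S f] sc S_def by blast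
  \<comment> \<open>The global argument, counted in full turns, is compared with each local phase.
    Both exponentiate to \<open>f\<close>, so the difference is an integer, constant on the
    connected set \<open>K c\<close>.\<close>
  define r where "r c z = Im (g z) / (2 * pi) - \<phi> c z" for c z
  have "\<exists>n::int. \<forall>z\<in>K c. r c z = n" if c: "c \<in> D" for c
  proof (rule integer_valued_constant[of "K c" "r c"])
    show "connected (K c)" using K c convex_connected by blast
    show "continuous_on (K c) (r c)"
      unfolding r_def by (intro continuous_intros cont c continuous_on_subset[OF g(1) KS[OF c]]) simp
    show "r c z \<in> \<int>" if z: "z \<in> K c" for z
    proof -
      have "exp (g z) = exp (2 * pi * \<phi> c z * \<i>)"
        using fe[OF c, of z] g(2)[of z] z KS[OF c] by (auto simp: e_def)
      then obtain n :: int where "g z = 2 * pi * \<phi> c z * \<i> + (of_int (2 * n) * pi) * \<i>"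
        unfolding exp_eq by blast
      then have "Im (g z) = 2 * pi * \<phi> c z + 2 * n * pi" by simp
      then have "r c z = n" by (simp add: r_def field_simps)
      then show ?thesis by simp
    qed
  qed blast
  then obtain n :: "'c \<Rightarrow> int" where n: "\<And>c z. c \<in> D \<Longrightarrow> z \<in> K c \<Longrightarrow> r c z = n c"
    by metis
  show thesis
  proof (rule that[of n])
    fix c d z assume "c \<in> D" "d \<in> D" "z \<in> K c" "z \<in> K d"
    then show "\<phi> c z + n c = \<phi> d z + n d"
      using n[of c z] n[of d z] by (simp add: r_def)
  qed
qed

section \<open>Corner sums and separable regions\<close>

text \<open>The mixed second difference. The entry \<open>(a, b)\<close> is a common corner of four
  cells, and an elementary checkerboard on any of them contributes with the sign of that corner.
  Indices range over all integers, so that border entries need no separate formula.\<close>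

definition corner_sum :: "(int \<Rightarrow> int \<Rightarrow> int) \<Rightarrow> int \<Rightarrow> int \<Rightarrow> int" where
  "corner_sum f a b = f a b + f (a - 1) (b - 1) - f (a - 1) b - f a (b - 1)"

text \<open>Adds to \<open>A\<close> the elementary checkerboards of all cells of \<open>D\<close>
  at once.\<close>

definition bump :: "(int \<Rightarrow> int \<Rightarrow> int) \<Rightarrow> (int \<times> int) set \<Rightarrow> int \<Rightarrow> int \<Rightarrow> int" where
  "bump A D = (\<lambda>a b. A a b + corner_sum (\<lambda>i k. of_bool ((i, k) \<in> D)) a b)"

definition zero_one :: "(int \<Rightarrow> int \<Rightarrow> int) \<Rightarrow> bool" where
  "zero_one A \<longleftrightarrow> (\<forall>a b. A a b \<in> {0, 1})"

text \<open>A positive switch in disguise: the corner sum of a rectangle lives on its four corners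
  only. \<open>U\<close> will be the grid of cells, which keeps these corners inside the
  matrix.\<close>

definition rectangle_step ::
    "(int \<times> int) set \<Rightarrow> (int \<Rightarrow> int \<Rightarrow> int) \<Rightarrow> (int \<Rightarrow> int \<Rightarrow> int) \<Rightarrow> bool" where
  "rectangle_step U A B \<longleftrightarrow> zero_one A \<and> zero_one B \<and>
    (\<exists>i j k l. i < j \<and> k < l \<and> {i..<j} \<times> {k..<l} \<subseteq> U \<and> B = bump A ({i..<j} \<times> {k..<l}))"

definition adj :: "int \<times> int \<Rightarrow> int \<times> int \<Rightarrow> bool" where
  "adj c d \<longleftrightarrow> \<bar>fst c - fst d\<bar> + \<bar>snd c - snd d\<bar> = 1"

text \<open>
  \<open>contact D i k l\<close>: columns \<open>k\<close> and \<open>l\<close> belong to the same maximal segment along which row \<open>i\<close>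
  of \<open>D\<close> touches row \<open>i + 1\<close>. A region is separable when every such segment cuts it; this
  replaces simple connectedness and, unlike it, is visibly inherited by the parts of a cut.
\<close>

definition contact :: "(int \<times> int) set \<Rightarrow> int \<Rightarrow> int \<Rightarrow> int \<Rightarrow> bool" where
  "contact D i k l \<longleftrightarrow> (\<forall>m. min k l \<le> m \<and> m \<le> max k l \<longrightarrow> (i, m) \<in> D \<and> (i + 1, m) \<in> D)"

definition separable :: "(int \<times> int) set \<Rightarrow> bool" where
  "separable D \<longleftrightarrow> (\<forall>i k. (i, k) \<in> D \<and> (i + 1, k) \<in> D \<longrightarrow>
    (\<exists>E\<subseteq>D. (i, k) \<in> E \<and> (i + 1, k) \<notin> E \<and>
      (\<forall>x\<in>E. \<forall>y\<in>D - E. adj x y \<longrightarrow> (\<exists>l. x = (i, l) \<and> y = (i + 1, l) \<and> contact D i k l))))"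

section \<open>Outward induction and maximal runs of integers\<close>

lemma int_interval_induct:
  fixes k :: int
  assumes "u \<le> k" "k \<le> v" "P k"
    and up: "\<And>m. u \<le> m \<Longrightarrow> m < v \<Longrightarrow> P m \<Longrightarrow> P (m + 1)"
    and down: "\<And>m. u < m \<Longrightarrow> m \<le> v \<Longrightarrow> P m \<Longrightarrow> P (m - 1)"
    and "u \<le> m" "m \<le> v"
  shows "P m"
proof (cases "k \<le> m")
  case True
  then have "m \<le> v \<longrightarrow> P m"
    by (induction m rule: int_ge_induct) (use assms in auto)
  then show ?thesis using assms by blast
next
  case False
  then have "m \<le> k" by simp
  then have "u \<le> m \<longrightarrow> P m"
    by (induction m rule: int_le_induct) (use assms in auto)
  then show ?thesis using assms by blast
qed

lemma maximal_run_up: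
  fixes P :: "int \<Rightarrow> bool"
  assumes "finite {m. P m}" and "P k"
  obtains v where "k \<le> v" "\<And>m. k \<le> m \<Longrightarrow> m \<le> v \<Longrightarrow> P m" "\<not> P (v + 1)"
proof -
  \<comment> \<open>The naturals do not embed into a finite set, so the run starting at
    \<open>k\<close> stops; \<open>n\<close> will be its length.\<close>
  have "\<not> inj_on (\<lambda>n. k + int n) UNIV \<or> \<not> (\<lambda>n. k + int n) ` UNIV \<subseteq> {m. P m}"
    using assms(1) by (meson finite_subset finite_imageD infinite_UNIV_nat)
  moreover have "inj_on (\<lambda>n. k + int n) UNIV" by (auto intro: injI)
  ultimately have ex: "\<exists>n. \<not> P (k + int n)" by blast
  define n where "n = (LEAST n. \<not> P (k + int n))"
  have n: "\<not> P (k + int n)" and lt: "\<And>j. j < n \<Longrightarrow> P (k + int j)"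
    using LeastI_ex[OF ex] not_less_Least unfolding n_def by blast+
  have "n \<noteq> 0" using n assms(2) by (metis add.right_neutral of_nat_0)
  show thesis
  proof (rule that[of "k + int n - 1"])
    show "P m" if "k \<le> m" "m \<le> k + int n - 1" for m
      using lt[of "nat (m - k)"] that by auto
  qed (use \<open>n \<noteq> 0\<close> n in auto)
qed

lemma maximal_run:
  fixes P :: "int \<Rightarrow> bool"
  assumes "finite {m. P m}" and "P k"
  obtains u v where "u \<le> k" "k \<le> v" "\<And>m. u \<le> m \<Longrightarrow> m \<le> v \<Longrightarrow> P m"
    "\<not> P (u - 1)" "\<not> P (v + 1)"
proof -
  obtain v where v: "k \<le> v" "\<And>m. k \<le> m \<Longrightarrow> m \<le> v \<Longrightarrow> P m" "\<not> P (v + 1)"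
    using maximal_run_up[OF assms] by blast
  \<comment> \<open>Reflection turns the search to the left into a search to the right.\<close>
  have "{m. P (- m)} = uminus ` {m. P m}" by force
  then have "finite {m. P (- m)}" using assms(1) by simp
  then obtain w where w: "- k \<le> w" "\<And>m. - k \<le> m \<Longrightarrow> m \<le> w \<Longrightarrow> P (- m)" "\<not> P (- (w + 1))"
    using maximal_run_up[of "\<lambda>m. P (- m)" "- k"] assms(2) by auto
  show thesis
  proof (rule that[of "- w" v])
    show "P m" if "- w \<le> m" "m \<le> v" for m
      using that v(2)[of m] w(2)[of "- m"] by (cases "k \<le> m") auto
    show "\<not> P (- w - 1)" using w(3) by (metis minus_add_distrib uminus_add_conv_diff add.commute)
  qed (use v w in auto)
qed

lemma adj_sym: "adj c d \<longleftrightarrow> adj d c"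
  by (auto simp: adj_def)

section \<open>Which part of a cut can be switched first\<close>

lemma zero_one_bump_bound:
  assumes "zero_one A" "zero_one (bump A D)"
  shows "\<bar>corner_sum (\<lambda>i k. of_bool ((i, k) \<in> D)) a b\<bar> \<le> 1"
proof -
  have "A a b \<in> {0, 1}" "bump A D a b \<in> {0, 1}" using assms by (auto simp: zero_one_def)
  then show ?thesis by (auto simp: bump_def)
qed

lemma corner_sum_disjoint_Un:
  assumes "X \<inter> Y = {}"
  shows "corner_sum (\<lambda>i k. of_bool ((i, k) \<in> X \<union> Y)) a b =
    corner_sum (\<lambda>i k. of_bool ((i, k) \<in> X)) a b + corner_sum (\<lambda>i k. of_bool ((i, k) \<in> Y)) a b"
proof -
  have "of_bool ((i, k) \<in> X \<union> Y) = (of_bool ((i, k) \<in> X) + of_bool ((i, k) \<in> Y) :: int)" for i k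
    using assms by (auto simp: of_bool_def)
  then show ?thesis unfolding corner_sum_def by simp
qed

lemma bump_bump: "X \<inter> Y = {} \<Longrightarrow> bump (bump A X) Y = bump A (X \<union> Y)"
  unfolding bump_def by (simp only: corner_sum_disjoint_Un) (simp add: fun_eq_iff)

text \<open>If both parts occur among the four cells around the entry, they can only occupy
  diagonally opposite cells, the other two cells being empty. The union would then have corner sum 2
  or -2, against the bound. So one part misses all four cells or its contributions cancel.\<close>

lemma corner_sum_split_zero:
  assumes disj: "X \<inter> Y = {}"
    and bd: "\<bar>corner_sum (\<lambda>i k. of_bool ((i, k) \<in> X \<union> Y)) a b\<bar> \<le> 1"
    and no: "\<And>x y. x \<in> X \<Longrightarrow> y \<in> Y \<Longrightarrow> adj x y \<Longrightarrow>
      {x, y} \<subseteq> {a - 1, a} \<times> {b - 1, b} \<Longrightarrow> False"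
  shows "corner_sum (\<lambda>i k. of_bool ((i, k) \<in> X)) a b = 0 \<or>
    corner_sum (\<lambda>i k. of_bool ((i, k) \<in> Y)) a b = 0"
proof -
  have n: "\<not> ((i, k) \<in> X \<and> (i', k') \<in> Y)"
    if "{i, i'} \<subseteq> {a - 1, a}" "{k, k'} \<subseteq> {b - 1, b}" "\<bar>i - i'\<bar> + \<bar>k - k'\<bar> = 1" for i k i' k'
    using no[of "(i, k)" "(i', k')"] that by (auto simp: adj_def)
  have "\<not> ((a, b) \<in> X \<and> (a - 1, b) \<in> Y)" "\<not> ((a, b) \<in> X \<and> (a, b - 1) \<in> Y)"
    "\<not> ((a - 1, b - 1) \<in> X \<and> (a - 1, b) \<in> Y)" "\<not> ((a - 1, b - 1) \<in> X \<and> (a, b - 1) \<in> Y)"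
    "\<not> ((a, b) \<in> Y \<and> (a - 1, b) \<in> X)" "\<not> ((a, b) \<in> Y \<and> (a, b - 1) \<in> X)"
    "\<not> ((a - 1, b - 1) \<in> Y \<and> (a - 1, b) \<in> X)" "\<not> ((a - 1, b - 1) \<in> Y \<and> (a, b - 1) \<in> X)"
    using n[of a a b b] n[of a "a - 1" b b] n[of a a b "b - 1"] n[of "a - 1" "a - 1" "b - 1" b]
      n[of "a - 1" a "b - 1" "b - 1"] n[of "a - 1" a b b] n[of a a "b - 1" b]
      n[of "a - 1" "a - 1" b "b - 1"] n[of a "a - 1" "b - 1" "b - 1"] by auto
  moreover have "\<not> (c \<in> X \<and> c \<in> Y)" for c using disj by auto
  ultimately show ?thesis
    using bd unfolding corner_sum_def Un_iff
    by (cases "(a, b) \<in> X"; cases "(a - 1, b - 1) \<in> X"; cases "(a - 1, b) \<in> X"; cases "(a, b - 1) \<in> X") auto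
qed

text \<open>
  At a corner of the contact which is not a reflex corner of the region, removing either part alone
  changes \<open>A\<close> by opposite amounts, so the entry of \<open>A\<close> there dictates which part goes first;
  everywhere else both orders are possible.
\<close>

lemma zero_one_bump_cut:
  assumes bin: "zero_one A" "zero_one (bump A (X \<union> Y))" and disj: "X \<inter> Y = {}" and "u \<le> v"
    and cut: "\<And>x y. x \<in> X \<Longrightarrow> y \<in> Y \<Longrightarrow> adj x y \<Longrightarrow>
      \<exists>m. u \<le> m \<and> m \<le> v \<and> x = (i, m) \<and> y = (i + 1, m)"
    and chord: "\<And>m. u \<le> m \<Longrightarrow> m \<le> v \<Longrightarrow> (i, m) \<in> X \<and> (i + 1, m) \<in> Y"
    and ends: "\<not> ((i, u - 1) \<in> X \<union> Y \<and> (i + 1, u - 1) \<in> X \<union> Y)"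
      "\<not> ((i, v + 1) \<in> X \<union> Y \<and> (i + 1, v + 1) \<in> X \<union> Y)"
    and reflex: "{(i, u - 1), (i + 1, u - 1), (i, v + 1), (i + 1, v + 1)} \<inter> (X \<union> Y) \<noteq> {}"
  shows "zero_one (bump A X) \<or> zero_one (bump A Y)"
proof -
  define cX where "cX = corner_sum (\<lambda>i k. of_bool ((i, k) \<in> X))"
  define cY where "cY = corner_sum (\<lambda>i k. of_bool ((i, k) \<in> Y))"
  have vals: "A a b \<in> {0, 1}" "A a b + (cX a b + cY a b) \<in> {0, 1}" for a b
    using bin unfolding zero_one_def bump_def cX_def cY_def corner_sum_disjoint_Un[OF disj] by auto
  have XY: "\<not> (c \<in> X \<and> c \<in> Y)" for c using disj by auto
  \<comment> \<open>The cut crosses only vertical contacts, so the cells just beyond the ends of the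
    segment can only belong to the part of their own row.\<close>
  have hX: "(i, u - 1) \<notin> Y" "(i, v + 1) \<notin> Y" "(i + 1, u - 1) \<notin> X" "(i + 1, v + 1) \<notin> X"
    using cut[of "(i, u)" "(i, u - 1)"] cut[of "(i, v)" "(i, v + 1)"]
      cut[of "(i + 1, u - 1)" "(i + 1, u)"] cut[of "(i + 1, v + 1)" "(i + 1, v)"]
      chord[of u] chord[of v] \<open>u \<le> v\<close> by (auto simp: adj_def)
  \<comment> \<open>Away from the segment, no pair of cells on opposite sides of the cut surrounds
    the entry.\<close>
  have off: "cX a b = 0 \<or> cY a b = 0" if "\<not> (a = i + 1 \<and> u \<le> b \<and> b \<le> v + 1)" for a b
    unfolding cX_def cY_def
  proof (rule corner_sum_split_zero[OF disj zero_one_bump_bound[OF bin]])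
    fix x y assume "x \<in> X" "y \<in> Y" "adj x y" "{x, y} \<subseteq> {a - 1, a} \<times> {b - 1, b}"
    with cut[of x y] that show False by auto
  qed
  \<comment> \<open>Inside the segment \<open>X\<close> holds both upper cells and neither lower
    one, and their signs cancel.\<close>
  have mid: "cX (i + 1) b = 0" if "u < b" "b \<le> v" for b
    using chord[of b] chord[of "b - 1"] that XY[of "(i + 1, b)"] XY[of "(i + 1, b - 1)"]
    by (auto simp: cX_def corner_sum_def)
  have left: "cX (i + 1) u = - 1 + of_bool ((i, u - 1) \<in> X)"
    "cY (i + 1) u = 1 - of_bool ((i + 1, u - 1) \<in> Y)"
    using chord[of u] \<open>u \<le> v\<close> XY[of "(i, u)"] XY[of "(i + 1, u)"] hX
    by (auto simp: cX_def cY_def corner_sum_def)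
  have right: "cX (i + 1) (v + 1) = 1 - of_bool ((i, v + 1) \<in> X)"
    "cY (i + 1) (v + 1) = - 1 + of_bool ((i + 1, v + 1) \<in> Y)"
    using chord[of v] \<open>u \<le> v\<close> XY[of "(i, v)"] XY[of "(i + 1, v)"] hX
    by (auto simp: cX_def cY_def corner_sum_def)
  \<comment> \<open>A reflex corner at one end makes one of the two corner sums vanish there, so at
    most one entry, at the other end, is left to dispute.\<close>
  have "\<exists>w. (\<forall>a b. (a, b) \<noteq> (i + 1, w) \<longrightarrow> cX a b = 0 \<or> cY a b = 0) \<and>
    (cX (i + 1) w = 0 \<or> cY (i + 1) w = 0 \<or> cX (i + 1) w + cY (i + 1) w = 0 \<and> \<bar>cX (i + 1) w\<bar> = 1)"
  proof (cases "(i, u - 1) \<in> X \<or> (i + 1, u - 1) \<in> Y")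
    case True
    have "cX a b = 0 \<or> cY a b = 0" if ne: "(a, b) \<noteq> (i + 1, v + 1)" for a b
    proof -
      consider "a \<noteq> i + 1 \<or> b < u \<or> v + 1 < b" | "a = i + 1" "b = u" | "a = i + 1" "u < b" "b \<le> v"
        using ne by force
      then show ?thesis by cases (use off[of a b] mid[of b] True left in auto)
    qed
    then show ?thesis using right by (intro exI[of _ "v + 1"]) auto
  next
    case False
    then have *: "(i, v + 1) \<in> X \<or> (i + 1, v + 1) \<in> Y" using reflex hX by auto
    have "cX a b = 0 \<or> cY a b = 0" if ne: "(a, b) \<noteq> (i + 1, u)" for a b
    proof -
      consider "a \<noteq> i + 1 \<or> b < u \<or> v + 1 < b" | "a = i + 1" "b = v + 1" | "a = i + 1" "u < b" "b \<le> v"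
        using ne by force
      then show ?thesis by cases (use off[of a b] mid[of b] right * in auto)
    qed
    then show ?thesis using left by (intro exI[of _ u]) auto
  qed
  then obtain w where w: "\<And>a b. (a, b) \<noteq> (i + 1, w) \<Longrightarrow> cX a b = 0 \<or> cY a b = 0"
    "cX (i + 1) w = 0 \<or> cY (i + 1) w = 0 \<or> cX (i + 1) w + cY (i + 1) w = 0 \<and> \<bar>cX (i + 1) w\<bar> = 1"
    by blast
  have other: "A a b + cX a b \<in> {0, 1}" "A a b + cY a b \<in> {0, 1}" if "(a, b) \<noteq> (i + 1, w)" for a b
    using w(1)[OF that] vals[of a b] by auto
  \<comment> \<open>If the changes at \<open>w\<close> are 1 and -1, an entry 0 admits the
    increasing part and an entry 1 the decreasing part.\<close>
  have "A (i + 1) w + cX (i + 1) w \<in> {0, 1} \<or> A (i + 1) w + cY (i + 1) w \<in> {0, 1}"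
    using w(2) vals[of "i + 1" w] by (auto simp: abs_if split: if_splits)
  then show ?thesis
    using other unfolding zero_one_def bump_def cX_def[symmetric] cY_def[symmetric] by (metis prod.inject)
qed

text \<open>At every entry one of the two corner sums vanishes, so \<open>bump A X\<close> agrees
  there with either \<open>A\<close> or \<open>bump A (X \<union> Y)\<close>.\<close>

lemma zero_one_bump_no_contact:
  assumes "zero_one A" "zero_one (bump A (X \<union> Y))" "X \<inter> Y = {}"
    and "\<And>x y. x \<in> X \<Longrightarrow> y \<in> Y \<Longrightarrow> \<not> adj x y"
  shows "zero_one (bump A X)"
  unfolding zero_one_def
proof (intro allI)
  fix a b
  have "corner_sum (\<lambda>i k. of_bool ((i, k) \<in> X)) a b = 0 \<or>
    corner_sum (\<lambda>i k. of_bool ((i, k) \<in> Y)) a b = 0"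
    by (rule corner_sum_split_zero[OF assms(3) zero_one_bump_bound[OF assms(1,2)]]) (use assms(4) in auto)
  moreover have "A a b \<in> {0, 1}" "bump A (X \<union> Y) a b \<in> {0, 1}"
    using assms(1,2) by (auto simp: zero_one_def)
  ultimately show "bump A X a b \<in> {0, 1}"
    unfolding bump_def corner_sum_disjoint_Un[OF assms(3)] by auto
qed

section \<open>Decomposition of a separable region into rectangles\<close>

text \<open>Closure of \<open>X\<close> under horizontal neighbours lets membership spread from
  column \<open>k\<close> along the whole contact segment. Hence contacts in \<open>D\<close>
  starting there are contacts in \<open>X\<close>, and a cut \<open>E\<close> of \<open>D\<close>
  restricts to \<open>E \<inter> X\<close>.\<close>

lemma separable_subset:
  assumes D: "separable D" and "X \<subseteq> D"
    and hor: "\<And>x y. x \<in> X \<Longrightarrow> y \<in> D \<Longrightarrow> adj x y \<Longrightarrow> fst x = fst y \<Longrightarrow> y \<in> X"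
  shows "separable X"
  unfolding separable_def
proof (intro allI impI)
  fix i k assume X: "(i, k) \<in> X \<and> (i + 1, k) \<in> X"
  then have "(i, k) \<in> D \<and> (i + 1, k) \<in> D" using \<open>X \<subseteq> D\<close> by blast
  then obtain E where E: "E \<subseteq> D" "(i, k) \<in> E" "(i + 1, k) \<notin> E"
    "\<And>x y. x \<in> E \<Longrightarrow> y \<in> D - E \<Longrightarrow> adj x y \<Longrightarrow>
      \<exists>l. x = (i, l) \<and> y = (i + 1, l) \<and> contact D i k l"
    using D unfolding separable_def by meson
  have "contact X i k l" if l: "contact D i k l" for l
    unfolding contact_def
  proof (intro allI impI)
    fix m assume m: "min k l \<le> m \<and> m \<le> max k l"
    show "(i, m) \<in> X \<and> (i + 1, m) \<in> X"
    proof (rule int_interval_induct[of "min k l" k "max k l" "\<lambda>m. (i, m) \<in> X \<and> (i + 1, m) \<in> X"])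
      show "(i, m + 1) \<in> X \<and> (i + 1, m + 1) \<in> X"
        if "min k l \<le> m" "m < max k l" "(i, m) \<in> X \<and> (i + 1, m) \<in> X" for m
        using hor[of "(i, m)" "(i, m + 1)"] hor[of "(i + 1, m)" "(i + 1, m + 1)"] that
          l[unfolded contact_def, rule_format, of "m + 1"] by (auto simp: adj_def)
      show "(i, m - 1) \<in> X \<and> (i + 1, m - 1) \<in> X"
        if "min k l < m" "m \<le> max k l" "(i, m) \<in> X \<and> (i + 1, m) \<in> X" for m
        using hor[of "(i, m)" "(i, m - 1)"] hor[of "(i + 1, m)" "(i + 1, m - 1)"] that
          l[unfolded contact_def, rule_format, of "m - 1"] by (auto simp: adj_def)
    qed (use X m in auto)
  qed
  then show "\<exists>E\<subseteq>X. (i, k) \<in> E \<and> (i + 1, k) \<notin> E \<and>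
      (\<forall>x\<in>E. \<forall>y\<in>X - E. adj x y \<longrightarrow> (\<exists>l. x = (i, l) \<and> y = (i + 1, l) \<and> contact X i k l))"
    using E X \<open>X \<subseteq> D\<close> by (intro exI[of _ "E \<inter> X"]) blast
qed

text \<open>Starting from a maximal run in the row of least index, flatness copies the run unchanged
  from each row to the next until the region stops below it. The rows passed form a rectangle with
  no neighbour in the rest.\<close>

lemma isolated_rectangle:
  assumes fin: "finite D" and "D \<noteq> {}"
    and flat: "\<And>i k. (i, k) \<in> D \<Longrightarrow> (i + 1, k) \<in> D \<Longrightarrow>
      ((i, k - 1) \<in> D \<longleftrightarrow> (i + 1, k - 1) \<in> D) \<and> ((i, k + 1) \<in> D \<longleftrightarrow> (i + 1, k + 1) \<in> D)"
  obtains i j k l where "i < j" "k < l" "{i..<j} \<times> {k..<l} \<subseteq> D"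
    "\<And>x y. x \<in> {i..<j} \<times> {k..<l} \<Longrightarrow> y \<in> D - {i..<j} \<times> {k..<l} \<Longrightarrow> \<not> adj x y"
proof -
  have "Min (fst ` D) \<in> fst ` D" using fin \<open>D \<noteq> {}\<close> by (intro Min_in) auto
  then obtain i k where ik: "(i, k) \<in> D" "i = Min (fst ` D)" by auto
  have top: "i \<le> fst x" if "x \<in> D" for x using that ik(2) fin by simp
  have "finite {m. (i, m) \<in> D}"
    by (rule finite_subset[of _ "snd ` D"]) (use fin in force)+
  from maximal_run[OF this, of k] ik(1) obtain u v where uv: "u \<le> k" "k \<le> v"
    "\<And>m. u \<le> m \<Longrightarrow> m \<le> v \<Longrightarrow> (i, m) \<in> D" "(i, u - 1) \<notin> D" "(i, v + 1) \<notin> D" by auto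
  have "finite {j. (j, k) \<in> D}"
    by (rule finite_subset[of _ "fst ` D"]) (use fin in force)+
  from maximal_run_up[OF this, of i] ik(1) obtain w where w: "i \<le> w"
    "\<And>j. i \<le> j \<Longrightarrow> j \<le> w \<Longrightarrow> (j, k) \<in> D" "(w + 1, k) \<notin> D" by auto
  \<comment> \<open>Row \<open>j\<close> has the columns from \<open>u\<close> to \<open>v\<close>
    as a maximal run.\<close>
  define full where "full j \<longleftrightarrow> (\<forall>m. u \<le> m \<longrightarrow> m \<le> v \<longrightarrow> (j, m) \<in> D) \<and>
    (j, u - 1) \<notin> D \<and> (j, v + 1) \<notin> D" for j
  \<comment> \<open>A single cell below a full row is enough: flatness spreads it along the row and
    also stops it at both ends.\<close>
  have full_Suc: "full (j + 1)" if "full j" "u \<le> m" "m \<le> v" "(j + 1, m) \<in> D" for j m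
  proof -
    have "(j + 1, n) \<in> D" if "u \<le> n" "n \<le> v" for n
    proof (rule int_interval_induct[of u m v])
      show "(j + 1, n + 1) \<in> D" if "u \<le> n" "n < v" "(j + 1, n) \<in> D" for n
        using flat[of j n] \<open>full j\<close> that by (auto simp: full_def)
      show "(j + 1, n - 1) \<in> D" if "u < n" "n \<le> v" "(j + 1, n) \<in> D" for n
        using flat[of j n] \<open>full j\<close> that by (auto simp: full_def)
    qed fact+
    then show ?thesis
      using flat[of j u] flat[of j v] \<open>full j\<close> uv(1,2) by (auto simp: full_def)
  qed
  have full: "full j" if "i \<le> j" "j \<le> w" for j
  proof -
    from that(1) have "j \<le> w \<longrightarrow> full j"
    proof (induction j rule: int_ge_induct)
      case base
      then show ?case using uv by (auto simp: full_def)
    next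
      case (step j)
      then show ?case using full_Suc[of j k] uv w(2)[of "j + 1"] by auto
    qed
    then show ?thesis using that by blast
  qed
  have below: "(w + 1, m) \<notin> D" if "u \<le> m" "m \<le> v" for m
    using full_Suc[OF full[OF w(1) order_refl] that] w(3) uv by (auto simp: full_def)
  show thesis
  proof (rule that[of i "w + 1" u "v + 1"])
    show "{i..<w + 1} \<times> {u..<v + 1} \<subseteq> D" using full by (auto simp: full_def)
    fix x y assume x: "x \<in> {i..<w + 1} \<times> {u..<v + 1}" and y: "y \<in> D - {i..<w + 1} \<times> {u..<v + 1}"
    show "\<not> adj x y"
    proof
      assume "adj x y"
      obtain a b a' b' where xy: "x = (a, b)" "y = (a', b')" by (cases x, cases y)
      have r: "i \<le> a" "a \<le> w" "u \<le> b" "b \<le> v" "(a', b') \<in> D"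
        "\<not> (i \<le> a' \<and> a' \<le> w \<and> u \<le> b' \<and> b' \<le> v)" "\<bar>a - a'\<bar> + \<bar>b - b'\<bar> = 1" "i \<le> a'"
        using x y \<open>adj x y\<close> top[of y] by (auto simp: xy adj_def)
      then have "a' = w + 1 \<and> b' = b \<or> a' = a \<and> b' = u - 1 \<or> a' = a \<and> b' = v + 1" by linarith
      then show False using r below[of b] full[of a] by (auto simp: full_def)
    qed
  qed (use uv w in auto)
qed

text \<open>Induction on the number of cells. A contact with a reflex end yields a cut, one part of
  which can go first; if there is none, an isolated rectangle is switched and the remaining cells
  follow.\<close>

lemma rectangle_steps_bump:
  assumes "finite D" "separable D" "D \<subseteq> U" "zero_one A" "zero_one (bump A D)"
  shows "(rectangle_step U)\<^sup>*\<^sup>* A (bump A D)"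
  using assms
proof (induction "card D" arbitrary: D A rule: less_induct)
  case less
  \<comment> \<open>If bumping by \<open>X\<close> alone stays zero-one, the induction hypothesis
    applies to \<open>X\<close> from \<open>A\<close>, and then to \<open>Y\<close> from the
    intermediate matrix.\<close>
  have step: "(rectangle_step U)\<^sup>*\<^sup>* A (bump A D)"
    if XY: "D = X \<union> Y" "X \<inter> Y = {}" "X \<noteq> {}" "Y \<noteq> {}" "separable X" "separable Y"
      and bin: "zero_one (bump A X)" for X Y
  proof -
    have c: "card X < card D" "card Y < card D"
      using XY \<open>finite D\<close> by (auto intro!: psubset_card_mono)
    have "(rectangle_step U)\<^sup>*\<^sup>* A (bump A X)"
      using less.prems XY bin by (intro less.hyps[OF c(1)]) auto
    moreover have "(rectangle_step U)\<^sup>*\<^sup>* (bump A X) (bump (bump A X) Y)"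
      using less.prems XY bin by (intro less.hyps[OF c(2)]) (auto simp: bump_bump)
    ultimately show ?thesis
      unfolding bump_bump[OF XY(2)] XY(1) by (rule rtranclp_trans)
  qed
  define flat where "flat i k \<longleftrightarrow> ((i, k - 1) \<in> D \<longleftrightarrow> (i + 1, k - 1) \<in> D) \<and>
    ((i, k + 1) \<in> D \<longleftrightarrow> (i + 1, k + 1) \<in> D)" for i k
  consider (empty) "D = {}"
    | (reflex) i k where "(i, k) \<in> D" "(i + 1, k) \<in> D" "\<not> flat i k"
    | (flat) "D \<noteq> {}" "\<And>i k. (i, k) \<in> D \<Longrightarrow> (i + 1, k) \<in> D \<Longrightarrow> flat i k"
    by blast
  then show ?case
  proof cases
    case empty
    then have "bump A D = A" by (simp add: bump_def corner_sum_def)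
    then show ?thesis by simp
  next
    case reflex
    have "finite {m. (i, m) \<in> D \<and> (i + 1, m) \<in> D}"
      by (rule finite_subset[of _ "snd ` D"]) (use \<open>finite D\<close> in force)+
    from maximal_run[OF this, of k] reflex(1,2) obtain u v where uv: "u \<le> k" "k \<le> v"
      "\<And>m. u \<le> m \<Longrightarrow> m \<le> v \<Longrightarrow> (i, m) \<in> D \<and> (i + 1, m) \<in> D"
      "\<not> ((i, u - 1) \<in> D \<and> (i + 1, u - 1) \<in> D)" "\<not> ((i, v + 1) \<in> D \<and> (i + 1, v + 1) \<in> D)"
      by blast
    from \<open>separable D\<close> reflex(1,2) obtain X where X: "X \<subseteq> D" "(i, k) \<in> X" "(i + 1, k) \<notin> X"
      and cut: "\<And>x y. x \<in> X \<Longrightarrow> y \<in> D - X \<Longrightarrow> adj x y \<Longrightarrow>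
        \<exists>l. x = (i, l) \<and> y = (i + 1, l) \<and> contact D i k l"
      unfolding separable_def by meson
    define Y where "Y = D - X"
    have XY: "D = X \<union> Y" "X \<inter> Y = {}" "X \<noteq> {}" "Y \<noteq> {}"
      using X reflex(2) by (auto simp: Y_def)
    have horX: "y \<in> X" if "x \<in> X" "y \<in> D" "adj x y" "fst x = fst y" for x y
      using cut[of x y] that by fastforce
    have horY: "y \<in> Y" if "x \<in> Y" "y \<in> D" "adj x y" "fst x = fst y" for x y
      using cut[of y x] that adj_sym[of x y] by (fastforce simp: Y_def)
    have sep: "separable X" "separable Y"
      using separable_subset[OF \<open>separable D\<close>, of X] separable_subset[OF \<open>separable D\<close>, of Y]
        horX horY XY(1) by blast+
    have chord: "(i, m) \<in> X \<and> (i + 1, m) \<in> Y" if "u \<le> m" "m \<le> v" for m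
    proof (rule int_interval_induct[of u k v])
      show "(i, m + 1) \<in> X \<and> (i + 1, m + 1) \<in> Y"
        if "u \<le> m" "m < v" "(i, m) \<in> X \<and> (i + 1, m) \<in> Y" for m
        using horX[of "(i, m)" "(i, m + 1)"] horY[of "(i + 1, m)" "(i + 1, m + 1)"] that
          uv(3)[of "m + 1"] by (auto simp: adj_def)
      show "(i, m - 1) \<in> X \<and> (i + 1, m - 1) \<in> Y"
        if "u < m" "m \<le> v" "(i, m) \<in> X \<and> (i + 1, m) \<in> Y" for m
        using horX[of "(i, m)" "(i, m - 1)"] horY[of "(i + 1, m)" "(i + 1, m - 1)"] that
          uv(3)[of "m - 1"] by (auto simp: adj_def)
    qed (use X reflex uv that in \<open>auto simp: Y_def\<close>)
    \<comment> \<open>A contact reaching from \<open>k\<close> beyond \<open>u\<close> or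
      \<open>v\<close> would contain column \<open>u - 1\<close> or \<open>v + 1\<close>, where the
      two rows do not touch.\<close>
    have inside: "u \<le> l \<and> l \<le> v" if "contact D i k l" for l
    proof -
      have "\<not> (min k l \<le> u - 1 \<and> u - 1 \<le> max k l)" "\<not> (min k l \<le> v + 1 \<and> v + 1 \<le> max k l)"
        using that uv(4,5) unfolding contact_def by blast+
      then show ?thesis using uv(1,2) by linarith
    qed
    \<comment> \<open>Failure of flatness on one side of \<open>k\<close> means that exactly one of
      the two cells there is in \<open>D\<close>; so \<open>k\<close> is the end of the segment on
      that side.\<close>
    have ends: "{(i, u - 1), (i + 1, u - 1), (i, v + 1), (i + 1, v + 1)} \<inter> (X \<union> Y) \<noteq> {}"
    proof -
      have "k = u" if "(i, k - 1) \<in> D \<longleftrightarrow> (i + 1, k - 1) \<notin> D"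
        using uv(1,2) uv(3)[of "k - 1"] that by fastforce
      moreover have "k = v" if "(i, k + 1) \<in> D \<longleftrightarrow> (i + 1, k + 1) \<notin> D"
        using uv(1,2) uv(3)[of "k + 1"] that by fastforce
      ultimately show ?thesis using reflex(3) XY(1) unfolding flat_def by auto
    qed
    have "zero_one (bump A X) \<or> zero_one (bump A Y)"
    proof (rule zero_one_bump_cut[where i = i and u = u and v = v])
      show "\<exists>m. u \<le> m \<and> m \<le> v \<and> x = (i, m) \<and> y = (i + 1, m)"
        if "x \<in> X" "y \<in> Y" "adj x y" for x y
        using cut[of x y] that inside by (auto simp: Y_def)
    qed (use less.prems uv chord ends XY in \<open>simp_all add: Un_commute\<close>)
    then show ?thesis
      using step[of X Y] step[of Y X] XY sep by (auto simp: Un_commute Int_commute)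
  next
    case flat
    from isolated_rectangle[OF \<open>finite D\<close> this[unfolded flat_def]] obtain i j k l
      where R: "i < j" "k < l" "{i..<j} \<times> {k..<l} \<subseteq> D"
        "\<And>x y. x \<in> {i..<j} \<times> {k..<l} \<Longrightarrow> y \<in> D - {i..<j} \<times> {k..<l} \<Longrightarrow> \<not> adj x y"
      by blast
    define X where "X = {i..<j} \<times> {k..<l}"
    define Y where "Y = D - X"
    have XY: "D = X \<union> Y" "X \<inter> Y = {}" "X \<noteq> {}" using R by (auto simp: X_def Y_def)
    have sep: "\<not> adj x y" if "x \<in> X" "y \<in> Y" for x y
      using R(4)[of x y] that by (simp add: X_def Y_def)
    have bin: "zero_one (bump A X)"
      using less.prems(4,5) XY(2) sep unfolding XY(1) by (rule zero_one_bump_no_contact)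
    have "rectangle_step U A (bump A X)"
      unfolding rectangle_step_def
    proof (intro conjI exI)
      show "bump A X = bump A ({i..<j} \<times> {k..<l})" by (simp add: X_def)
    qed (use bin less.prems(3,4) R(1-3) in auto)
    moreover have "(rectangle_step U)\<^sup>*\<^sup>* (bump A X) (bump (bump A X) Y)"
    proof (rule less.hyps)
      show "card Y < card D" using XY \<open>finite D\<close> by (intro psubset_card_mono) auto
      show "finite Y" "Y \<subseteq> U" using less.prems(1,3) by (auto simp: Y_def)
      show "separable Y"
        by (rule separable_subset[OF \<open>separable D\<close>])
          (use sep adj_sym XY(1) in blast)+
      show "zero_one (bump (bump A X) Y)"
        using less.prems(5) bump_bump[OF XY(2)] XY(1) by simp
    qed (use bin in simp)
    ultimately have "(rectangle_step U)\<^sup>*\<^sup>* A (bump (bump A X) Y)"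
      by (rule converse_rtranclp_into_rtranclp)
    then show ?thesis unfolding bump_bump[OF XY(2)] XY(1)[symmetric] .
  qed
qed

section \<open>Polyominoes are separable\<close>

text \<open>The counterpart of \<open>cell_region\<close> for integer indices, with the same
  orientation.\<close>

definition int_cell :: "int \<times> int \<Rightarrow> complex set" where
  "int_cell c =
    cbox (Complex (snd c) (fst c)) (Complex (snd c + 1) (fst c + 1))"

lemma mem_int_cell:
  "z \<in> int_cell (i, k) \<longleftrightarrow>
    real_of_int k \<le> Re z \<and> Re z \<le> k + 1 \<and> real_of_int i \<le> Im z \<and> Im z \<le> i + 1"
  by (auto simp: int_cell_def in_cbox_complex_iff)

lemma adj_int_cells_meet:
  assumes "adj c d"
  obtains z where "z \<in> int_cell c" "z \<in> int_cell d"
proof -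
  obtain i k i' k' where cd: "c = (i, k)" "d = (i', k')" by (cases c, cases d)
  have "\<bar>i - i'\<bar> \<le> 1 \<and> \<bar>k - k'\<bar> \<le> 1" using assms by (auto simp: adj_def cd)
  then show thesis
    \<comment> \<open>The maxima of the coordinates give a vertex common to both squares.\<close>
    by (intro that[of "Complex (max k k') (max i i')"]) (auto simp: cd mem_int_cell)
qed

text \<open>
  The circle-valued map \<open>exp (2 \<pi> \<i> \<phi>)\<close> below winds once across the contact segment and is constant
  away from the cells along it. The band in which it winds lies, at either end of the segment, on
  the side that does not extend beyond that end; \<open>s\<close> interpolates between the two sides.
\<close>

lemma simply_connected_contact_cut:
  assumes fin: "finite D" and sc: "simply_connected (\<Union>c\<in>D. int_cell c)"
    and ik: "(i, k) \<in> D" "(i + 1, k) \<in> D"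
  obtains E where "E \<subseteq> D" "(i, k) \<in> E" "(i + 1, k) \<notin> E"
    "\<And>x y. x \<in> E \<Longrightarrow> y \<in> D - E \<Longrightarrow> adj x y \<Longrightarrow>
      \<exists>l. x = (i, l) \<and> y = (i + 1, l) \<and> contact D i k l"
proof -
  have "finite {m. (i, m) \<in> D \<and> (i + 1, m) \<in> D}"
    by (rule finite_subset[of _ "snd ` D"]) (use fin in force)+
  from maximal_run[OF this, of k] ik obtain u v where uv: "u \<le> k" "k \<le> v"
    "\<And>m. u \<le> m \<Longrightarrow> m \<le> v \<Longrightarrow> (i, m) \<in> D \<and> (i + 1, m) \<in> D"
    "\<not> ((i, u - 1) \<in> D \<and> (i + 1, u - 1) \<in> D)" "\<not> ((i, v + 1) \<in> D \<and> (i + 1, v + 1) \<in> D)"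
    by blast
  \<comment> \<open>The value 1 records that row \<open>i\<close> stops at that end, the value 0
    that it goes on; in the latter case maximality of the segment makes row \<open>i + 1\<close>
    stop.\<close>
  define sl sr :: real where "sl = of_bool ((i, u - 1) \<notin> D)" and "sr = of_bool ((i, v + 1) \<notin> D)"
  define t where "t x = (x - u) / (v + 1 - u)" for x :: real
  define s where "s x = (1 - t x) * sl + t x * sr" for x
  \<comment> \<open>\<open>\<psi>\<close> climbs from 0 to 1 within row \<open>i\<close> where
    \<open>s\<close> is 1, and within row \<open>i + 1\<close> where \<open>s\<close> is 0.\<close>
  define \<psi> where "\<psi> z = max 0 (min 1 (Im z - (i + 1) + s (Re z)))" for z
  define upper where "upper c \<longleftrightarrow> fst c = i \<and> u \<le> snd c \<and> snd c \<le> v" for c :: "int \<times> int"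
  define lower where "lower c \<longleftrightarrow> fst c = i + 1 \<and> u \<le> snd c \<and> snd c \<le> v" for c :: "int \<times> int"
  \<comment> \<open>Subtracting 1 on the lower strip makes the phase 0 on its far edge, at the price
    of an integer jump across the contact.\<close>
  define \<phi> where "\<phi> c z = (if upper c then \<psi> z else if lower c then \<psi> z - 1 else 0)" for c z
  have pos: "0 < real_of_int (v + 1 - u)" using uv by simp
  have ends: "s u = sl" "s (v + 1) = sr" using pos by (auto simp: s_def t_def)
  have lr: "sl \<in> {0, 1}" "sr \<in> {0, 1}" by (auto simp: sl_def sr_def)
  have s01: "0 \<le> s x \<and> s x \<le> 1" if "u \<le> x" "x \<le> v + 1" for x :: real
  proof -
    have "0 \<le> t x" "t x \<le> 1" using that pos by (auto simp: t_def field_simps)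
    then show ?thesis using lr by (auto simp: s_def)
  qed
  \<comment> \<open>Integrality is needed also where closed squares meet only in a corner. Across a
    shared edge the phase is exactly 0, which later forces equal branches.\<close>
  have strip_other: "\<phi> c z \<in> \<int> \<and> (adj c d \<longrightarrow> \<phi> c z = 0)"
    if cd: "c \<in> D" "d \<in> D" "z \<in> int_cell c" "z \<in> int_cell d"
      and c: "upper c \<or> lower c" and d: "\<not> (upper d \<or> lower d)" for c d z
  proof -
    obtain a b a' b' where ab: "c = (a, b)" "d = (a', b')" by (cases c, cases d)
    have z: "real_of_int b \<le> Re z" "Re z \<le> b + 1" "real_of_int a \<le> Im z" "Im z \<le> a + 1"
      "real_of_int b' \<le> Re z" "Re z \<le> b' + 1" "real_of_int a' \<le> Im z" "Im z \<le> a' + 1"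
      using cd unfolding ab mem_int_cell by auto
    then have near: "a \<le> a' + 1" "a' \<le> a + 1" "b \<le> b' + 1" "b' \<le> b + 1" by linarith+
    have b: "u \<le> b" "b \<le> v" and a: "a = i \<or> a = i + 1"
      using c by (auto simp: ab upper_def lower_def)
    have zs: "0 \<le> s (Re z)" "s (Re z) \<le> 1" using s01[of "Re z"] z b by auto
    have d': "a' = i \<or> a' = i + 1 \<Longrightarrow> b' < u \<or> v < b'"
      using d by (auto simp: ab upper_def lower_def)
    \<comment> \<open>A cell outside the strips in row \<open>i\<close> or \<open>i + 1\<close> can
      touch them only at an end, where \<open>s\<close> takes the value chosen for that end.\<close>
    have side: "b' = u - 1 \<and> Re z = u \<and> s (Re z) = sl \<or>
        b' = v + 1 \<and> Re z = v + 1 \<and> s (Re z) = sr" if "b' < u \<or> v < b'"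
      using that
    proof
      assume "b' < u"
      then have "b' = u - 1" using near b by linarith
      moreover from this have "Re z = u" using z b by linarith
      ultimately show ?thesis using ends by simp
    next
      assume "v < b'"
      then have "b' = v + 1" using near b by linarith
      moreover from this have "Re z = v + 1" using z b by linarith
      ultimately show ?thesis using ends by simp
    qed
    show ?thesis
    proof (cases "a = i")
      case True
      then have \<phi>: "\<phi> c z = \<psi> z" using b by (auto simp: \<phi>_def ab upper_def)
      consider "a' = i - 1" | "a' = i" | "a' = i + 1" using near True by linarith
      then show ?thesis
      proof cases
        case 1
        then have "\<psi> z = 0" using z zs by (auto simp: \<psi>_def)
        then show ?thesis using \<phi> by simp
      next
        case 2
        then have "s (Re z) = 0" using side[OF d'] cd(2) by (auto simp: sl_def sr_def ab)
        then have "\<psi> z = 0" using z True by (auto simp: \<psi>_def)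
        then show ?thesis using \<phi> by simp
      next
        case 3
        then have "Im z = i + 1" using z True by auto
        moreover have "s (Re z) \<in> {0, 1}" using side[OF d'] 3 lr by auto
        ultimately have "\<psi> z \<in> \<int>" by (auto simp: \<psi>_def)
        then show ?thesis using \<phi> d' b 3 True by (auto simp: ab adj_def)
      qed
    next
      case False
      then have a: "a = i + 1" using a by simp
      then have \<phi>: "\<phi> c z = \<psi> z - 1" using b by (auto simp: \<phi>_def ab upper_def lower_def)
      consider "a' = i" | "a' = i + 1" | "a' = i + 2" using near a by linarith
      then show ?thesis
      proof cases
        case 1
        then have "Im z = i + 1" using z a by auto
        moreover have "s (Re z) \<in> {0, 1}" using side[OF d'] 1 lr by auto
        ultimately have "\<psi> z - 1 \<in> \<int>" by (auto simp: \<psi>_def)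
        then show ?thesis using \<phi> d' b 1 a by (auto simp: ab adj_def)
      next
        case 2
        then have "s (Re z) = 1" using side[OF d'] cd(2) uv(4,5) by (auto simp: sl_def sr_def ab)
        then have "\<psi> z = 1" using z a by (auto simp: \<psi>_def)
        then show ?thesis using \<phi> by simp
      next
        case 3
        then have "\<psi> z = 1" using z zs by (auto simp: \<psi>_def)
        then show ?thesis using \<phi> by simp
      qed
    qed
  qed
  obtain h :: "int \<times> int \<Rightarrow> int" where
    h: "\<And>c d z. c \<in> D \<Longrightarrow> d \<in> D \<Longrightarrow> z \<in> int_cell c \<Longrightarrow> z \<in> int_cell d \<Longrightarrow> \<phi> c z + h c = \<phi> d z + h d"
  proof (rule simply_connected_phase_lift[OF fin _ sc, of \<phi>])
    show "closed (int_cell c) \<and> convex (int_cell c)" for c by (simp add: int_cell_def closed_cbox)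
    show "continuous_on (int_cell c) (\<phi> c)" for c
    proof -
      have "continuous_on (int_cell c) \<psi>"
        unfolding \<psi>_def s_def t_def using pos by (intro continuous_intros) auto
      then show ?thesis
        by (cases "upper c"; cases "lower c") (auto simp: \<phi>_def intro!: continuous_intros)
    qed
    show "\<phi> c z - \<phi> d z \<in> \<int>"
      if "c \<in> D" "d \<in> D" "z \<in> int_cell c" "z \<in> int_cell d" for c d z
    proof (cases "upper c \<or> lower c"; cases "upper d \<or> lower d")
      assume "upper c \<or> lower c" "\<not> (upper d \<or> lower d)"
      then show ?thesis using strip_other[of c d z] that by (auto simp: \<phi>_def)
    next
      assume "\<not> (upper c \<or> lower c)" "upper d \<or> lower d"
      then show ?thesis using strip_other[of d c z] that by (auto simp: \<phi>_def)
    qed (auto simp: \<phi>_def)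
  qed blast
  \<comment> \<open>At a common point the phases are \<open>\<psi> z\<close> and
    \<open>\<psi> z - 1\<close>, so the branch rises by 1.\<close>
  have jump: "h d = h c + 1" if "c \<in> D" "d \<in> D" "adj c d" "upper c" "lower d" for c d
  proof -
    obtain z where "z \<in> int_cell c" "z \<in> int_cell d" using \<open>adj c d\<close> by (rule adj_int_cells_meet)
    then show ?thesis using h[of c d z] that by (auto simp: \<phi>_def upper_def lower_def)
  qed
  have same: "h d = h c" if "c \<in> D" "d \<in> D" "adj c d"
    "\<not> (upper c \<and> lower d)" "\<not> (upper d \<and> lower c)" for c d
  proof -
    obtain z where z: "z \<in> int_cell c" "z \<in> int_cell d" using \<open>adj c d\<close> by (rule adj_int_cells_meet)
    have "\<phi> c z = \<phi> d z"
    proof (cases "upper c \<or> lower c"; cases "upper d \<or> lower d")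
      assume "upper c \<or> lower c" "\<not> (upper d \<or> lower d)"
      then show ?thesis using strip_other[of c d z] that z by (auto simp: \<phi>_def)
    next
      assume "\<not> (upper c \<or> lower c)" "upper d \<or> lower d"
      then show ?thesis using strip_other[of d c z] that z adj_sym[of c d] by (auto simp: \<phi>_def)
    qed (use that in \<open>auto simp: \<phi>_def\<close>)
    then show ?thesis using h[of c d z] that z by simp
  qed
  have row: "h (i, m) = h (i, k)" if "u \<le> m" "m \<le> v" for m
  proof (rule int_interval_induct[of u k v "\<lambda>m. h (i, m) = h (i, k)"])
    show "h (i, m + 1) = h (i, k)" if "u \<le> m" "m < v" "h (i, m) = h (i, k)" for m
      using same[of "(i, m)" "(i, m + 1)"] uv(3)[of m] uv(3)[of "m + 1"] that
      by (auto simp: adj_def lower_def)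
    show "h (i, m - 1) = h (i, k)" if "u < m" "m \<le> v" "h (i, m) = h (i, k)" for m
      using same[of "(i, m)" "(i, m - 1)"] uv(3)[of m] uv(3)[of "m - 1"] that
      by (auto simp: adj_def lower_def)
  qed (use uv that in auto)
  show thesis
  \<comment> \<open>The cut consists of the cells lying on the same branch of the logarithm as
    \<open>(i, k)\<close>.\<close>
  proof (rule that[of "{c \<in> D. h c = h (i, k)}"])
    show "(i + 1, k) \<notin> {c \<in> D. h c = h (i, k)}"
      using jump[of "(i, k)" "(i + 1, k)"] ik uv(1,2) by (auto simp: adj_def upper_def lower_def)
    fix x y assume x: "x \<in> {c \<in> D. h c = h (i, k)}" and y: "y \<in> D - {c \<in> D. h c = h (i, k)}"
      and xy: "adj x y"
    \<comment> \<open>All upper strip cells share the branch of \<open>(i, k)\<close>, so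
      \<open>y\<close> is not one of them; as the branch changes between \<open>x\<close> and
      \<open>y\<close>, their common edge must lie on the contact.\<close>
    have "\<not> upper y" using row[of "snd y"] y by (cases y) (auto simp: upper_def)
    then have "upper x" "lower y" using same[of x y] x y xy by auto
    then obtain l where l: "x = (i, l)" "y = (i + 1, l)" "u \<le> l" "l \<le> v"
      using xy by (cases x; cases y) (auto simp: upper_def lower_def adj_def)
    moreover have "contact D i k l" using uv l by (auto simp: contact_def)
    ultimately show "\<exists>l. x = (i, l) \<and> y = (i + 1, l) \<and> contact D i k l" by blast
  qed (use ik in auto)
qed

text \<open>A cut of a component is a cut of the whole region, because adjacency never leaves the
  component.\<close>

lemma separable_if_components_simply_connected:
  assumes "finite D"
    and comp: "\<And>c. c \<in> D \<Longrightarrow> \<exists>K\<subseteq>D. c \<in> K \<and> (\<forall>x\<in>K. \<forall>y\<in>D. adj x y \<longrightarrow> y \<in> K) \<and>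
      simply_connected (\<Union>c\<in>K. int_cell c)"
  shows "separable D"
  unfolding separable_def
proof (intro allI impI)
  fix i k assume ik: "(i, k) \<in> D \<and> (i + 1, k) \<in> D"
  obtain K where K: "K \<subseteq> D" "(i, k) \<in> K" "\<And>x y. x \<in> K \<Longrightarrow> y \<in> D \<Longrightarrow> adj x y \<Longrightarrow> y \<in> K"
    "simply_connected (\<Union>c\<in>K. int_cell c)"
    using comp ik by meson
  have "(i + 1, k) \<in> K" using K(3)[of "(i, k)" "(i + 1, k)"] K(2) ik by (auto simp: adj_def)
  moreover have "finite K" using K(1) \<open>finite D\<close> finite_subset by blast
  ultimately obtain E where E: "E \<subseteq> K" "(i, k) \<in> E" "(i + 1, k) \<notin> E"
    "\<And>x y. x \<in> E \<Longrightarrow> y \<in> K - E \<Longrightarrow> adj x y \<Longrightarrow>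
      \<exists>l. x = (i, l) \<and> y = (i + 1, l) \<and> contact K i k l"
    using simply_connected_contact_cut[of K i k] K(2,4) by metis
  have mono: "contact D i k l" if "contact K i k l" for l
    using that K(1) unfolding contact_def by blast
  show "\<exists>E\<subseteq>D. (i, k) \<in> E \<and> (i + 1, k) \<notin> E \<and>
      (\<forall>x\<in>E. \<forall>y\<in>D - E. adj x y \<longrightarrow> (\<exists>l. x = (i, l) \<and> y = (i + 1, l) \<and> contact D i k l))"
  proof (intro exI[of _ E] conjI ballI impI)
    fix x y assume "x \<in> E" "y \<in> D - E" "adj x y"
    then show "\<exists>l. x = (i, l) \<and> y = (i + 1, l) \<and> contact D i k l"
      using E(4)[of x y] E(1) K(3)[of x y] mono by blast
  qed (use E K(1) in auto)
qed

section \<open>From regions to matrices\<close>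

text \<open>Extension by zero makes the cells missing around a border entry contribute nothing to
  its corner sum.\<close>

definition padded :: "(nat \<times> nat \<Rightarrow> int) \<Rightarrow> nat \<Rightarrow> nat \<Rightarrow> int \<Rightarrow> int \<Rightarrow> int" where
  "padded f m n i k =
    (if 0 \<le> i \<and> i < int m \<and> 0 \<le> k \<and> k < int n then f (nat i, nat k) else 0)"

lemma padded_of_nat: "padded f m n (int i) (int k) = of_bool (i < m) * of_bool (k < n) * f (i, k)"
  by (simp add: padded_def)

lemma padded_negative: "i < 0 \<or> k < 0 \<Longrightarrow> padded f m n i k = 0"
  by (auto simp: padded_def)

text \<open>Each delta selects one term. The guard \<open>0 < b\<close> matters because
  \<open>b - 1\<close> is truncated subtraction.\<close>

lemma sum_mult_consecutive_deltas:
  fixes g :: "nat \<Rightarrow> int"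
  shows "(\<Sum>k<n. g k * (of_bool (b = k) - of_bool (b = k + 1))) =
    of_bool (b < n) * g b - of_bool (0 < b \<and> b - 1 < n) * g (b - 1)"
proof -
  have "(\<Sum>k<n. g k * of_bool (b = k)) = of_bool (b < n) * g b"
    by (simp add: of_bool_def if_distrib[of "(*) _"] cong: if_cong)
  moreover have "(\<Sum>k<n. g k * of_bool (b = k + 1)) = of_bool (0 < b \<and> b - 1 < n) * g (b - 1)"
    by (cases b) (simp_all add: of_bool_def if_distrib[of "(*) _"] cong: if_cong)
  ultimately show ?thesis by (simp add: right_diff_distrib sum_subtractf)
qed

text \<open>An elementary checkerboard is a product of a row difference and a column difference of
  deltas, so the double sum is evaluated one index at a time.\<close>

lemma sum_checkerboard_mat:
  fixes f :: "nat \<times> nat \<Rightarrow> int"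
  assumes "a < p" "b < q"
  shows "(\<Sum>i<m. \<Sum>k<n. f (i, k) * checkerboard_mat p q i (i + 1) k (k + 1) $$ (a, b)) =
    corner_sum (padded f m n) (int a) (int b)"
proof -
  have "checkerboard_mat p q i (i + 1) k (k + 1) $$ (a, b) =
      (of_bool (a = i) - of_bool (a = i + 1)) * (of_bool (b = k) - of_bool (b = k + 1))" for i k
    using assms by (auto simp: checkerboard_mat_def)
  moreover have pred: "int (Suc x) - 1 = int x" for x by simp
  ultimately have "(\<Sum>i<m. \<Sum>k<n. f (i, k) * checkerboard_mat p q i (i + 1) k (k + 1) $$ (a, b)) =
      (\<Sum>i<m. (\<Sum>k<n. f (i, k) * (of_bool (b = k) - of_bool (b = k + 1))) *
        (of_bool (a = i) - of_bool (a = i + 1)))"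
    unfolding sum_distrib_right by (intro sum.cong refl) simp
  also have "\<dots> = corner_sum (padded f m n) (int a) (int b)"
    unfolding sum_mult_consecutive_deltas
    \<comment> \<open>Index 0 is treated apart from successors: there the predecessor is -1, where
      the padding vanishes.\<close>
    by (cases a; cases b)
      (simp_all add: corner_sum_def padded_of_nat padded_of_nat[where i = 0, simplified]
        padded_of_nat[where k = 0, simplified] padded_of_nat[where i = 0 and k = 0, simplified]
        padded_negative pred algebra_simps del: of_nat_Suc)
  finally show ?thesis .
qed

text \<open>The indicator of a rectangle is a product of interval indicators, so its mixed
  difference factors; the result is the checkerboard matrix on the four corners.\<close>

lemma corner_sum_rectangle:
  assumes "i < j" "k < l"
  shows "corner_sum (\<lambda>a b. of_bool ((a, b) \<in> {i..<j} \<times> {k..<l})) a b =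
    (of_bool (a = i) - of_bool (a = j)) * (of_bool (b = k) - of_bool (b = l))"
proof -
  have "of_bool (x \<in> {i..<j}) - of_bool (x - 1 \<in> {i..<j}) = (of_bool (x = i) - of_bool (x = j) :: int)"
    if "i < j" for x i j :: int
    using that by (auto simp: of_bool_def)
  note d = this[OF assms(1), of a] this[OF assms(2), of b]
  show ?thesis
    unfolding d[symmetric] by (simp only: corner_sum_def mem_Times_iff fst_conv snd_conv of_bool_conj)
      (simp only: algebra_simps)
qed

definition to_mat :: "nat \<Rightarrow> nat \<Rightarrow> (int \<Rightarrow> int \<Rightarrow> int) \<Rightarrow> int Matrix.mat" where
  "to_mat p q g = Matrix.mat p q (\<lambda>(a, b). g (int a) (int b))"

lemma dim_to_mat [simp]: "dim_row (to_mat p q g) = p" "dim_col (to_mat p q g) = q"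
  by (simp_all add: to_mat_def)

lemma to_mat_padded:
  assumes "A \<in> carrier_mat p q"
  shows "to_mat p q (padded (\<lambda>c. A $$ c) p q) = A"
  using assms by (intro eq_matI) (auto simp: to_mat_def padded_def)

section \<open>Rectangle steps as arcs of the switch graph\<close>

text \<open>A change by 1 or -1 between zero-one entries determines both values, which forces a
  negative checkerboard before and a positive one after. The deltas cancel in every row and column,
  so the margins persist.\<close>

lemma rectangle_step_to_mat:
  assumes R: "R \<in> carrier_vec p" and C: "C \<in> carrier_vec q"
    and step: "rectangle_step ({0..<int (p - 1)} \<times> {0..<int (q - 1)}) g g'"
    and g: "to_mat p q g \<in> matrix_class R C"
  shows "positive_switch (to_mat p q g) (to_mat p q g')" "to_mat p q g' \<in> matrix_class R C"
proof -
  obtain i' j' k' l' where r: "i' < j'" "k' < l'"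
    "{i'..<j'} \<times> {k'..<l'} \<subseteq> {0..<int (p - 1)} \<times> {0..<int (q - 1)}"
    and g': "g' = bump g ({i'..<j'} \<times> {k'..<l'})" and bin: "zero_one g" "zero_one g'"
    using step unfolding rectangle_step_def by (elim conjE exE) (rule that)
  have "(i', k') \<in> {0..<int (p - 1)} \<times> {0..<int (q - 1)}"
    "(j' - 1, l' - 1) \<in> {0..<int (p - 1)} \<times> {0..<int (q - 1)}"
    by (rule subsetD[OF r(3)], use r(1,2) in simp)+
  then have bounds: "0 \<le> i'" "j' \<le> int (p - 1)" "0 \<le> k'" "l' \<le> int (q - 1)" by auto
  define i j k l where "i = nat i'" and "j = nat j'" and "k = nat k'" and "l = nat l'"
  have nats: "i' = int i" "j' = int j" "k' = int k" "l' = int l"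
    using bounds r by (simp_all add: i_def j_def k_def l_def)
  \<comment> \<open>A rectangle of cells ends at most at row \<open>p - 1\<close> of the matrix, one
    more than the last cell row, so all four corners are matrix positions.\<close>
  have ij: "i < j" "j < p" "k < l" "l < q" using bounds r(1,2) by (auto simp: nats)
  have val: "g' (int a) (int b) = g (int a) (int b) +
      (of_bool (a = i) - of_bool (a = j)) * (of_bool (b = k) - of_bool (b = l))" for a b
    unfolding g' bump_def corner_sum_rectangle[OF r(1,2)] by (simp add: nats)
  have corners: "g (int i) (int k) = 0" "g (int i) (int l) = 1" "g (int j) (int k) = 1"
    "g (int j) (int l) = 0" "g' (int i) (int k) = 1" "g' (int i) (int l) = 0"
    "g' (int j) (int k) = 0" "g' (int j) (int l) = 1"
  proof -
    have vals: "g a b \<in> {0, 1}" "g' a b \<in> {0, 1}" for a b using bin by (auto simp: zero_one_def)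
    have up: "g a b = 0" "g' a b = 1" if "g' a b = g a b + 1" for a b
      using vals[of a b] that by auto
    have down: "g a b = 1" "g' a b = 0" if "g' a b = g a b - 1" for a b
      using vals[of a b] that by auto
    have "g' (int i) (int k) = g (int i) (int k) + 1" "g' (int i) (int l) = g (int i) (int l) - 1"
      "g' (int j) (int k) = g (int j) (int k) - 1" "g' (int j) (int l) = g (int j) (int l) + 1"
      using ij by (simp_all add: val)
    then show "g (int i) (int k) = 0" "g (int i) (int l) = 1" "g (int j) (int k) = 1"
      "g (int j) (int l) = 0" "g' (int i) (int k) = 1" "g' (int i) (int l) = 0"
      "g' (int j) (int k) = 0" "g' (int j) (int l) = 1"
      using up down by blast+
  qed
  have "negative_checkerboard (to_mat p q g) i j k l" "positive_checkerboard (to_mat p q g') i j k l"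
    using ij corners
    by (auto simp: negative_checkerboard_def positive_checkerboard_def to_mat_def)
  moreover have "to_mat p q g' $$ (a, b) = to_mat p q g $$ (a, b)"
    if "a < p" "b < q" "(a, b) \<notin> {i, j} \<times> {k, l}" for a b
    using that val[of a b] by (auto simp: to_mat_def)
  ultimately show "positive_switch (to_mat p q g) (to_mat p q g')"
    unfolding positive_switch_def
    by (intro conjI exI[of _ i] exI[of _ j] exI[of _ k] exI[of _ l]) simp_all
  have dims: "dim_vec R = p" "dim_vec C = q" using R C by auto
  have row: "(\<Sum>b<q. g' (int a) (int b)) = (\<Sum>b<q. g (int a) (int b))" for a
  proof -
    have "(\<Sum>b<q. of_bool (b = k) - of_bool (b = l) :: int) = 0"
      using ij by (simp add: sum_subtractf of_bool_def)
    then show ?thesis by (simp add: val sum.distrib flip: sum_distrib_left)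
  qed
  have col: "(\<Sum>a<p. g' (int a) (int b)) = (\<Sum>a<p. g (int a) (int b))" for b
  proof -
    have "(\<Sum>a<p. of_bool (a = i) - of_bool (a = j) :: int) = 0"
      using ij by (simp add: sum_subtractf of_bool_def)
    then show ?thesis by (simp add: val sum.distrib flip: sum_distrib_right)
  qed
  have "elements_mat (to_mat p q g') \<subseteq> {0, 1}"
    using bin(2) by (auto simp: elements_mat_def to_mat_def zero_one_def)
  then show "to_mat p q g' \<in> matrix_class R C"
    using g row col by (simp add: matrix_class_def dims to_mat_def)
qed

lemma reachable_of_rectangle_steps:
  assumes R: "R \<in> carrier_vec p" and C: "C \<in> carrier_vec q"
    and steps: "(rectangle_step ({0..<int (p - 1)} \<times> {0..<int (q - 1)}))\<^sup>*\<^sup>* g g'"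
    and g: "to_mat p q g \<in> matrix_class R C"
  shows "to_mat p q g \<rightarrow>\<^sup>*\<^bsub>with_proj (switch_digraph R C)\<^esub> to_mat p q g'"
proof -
  interpret wf_digraph "with_proj (switch_digraph R C)"
    by unfold_locales (auto simp: switch_digraph_def)
  from steps have "to_mat p q g' \<in> matrix_class R C \<and>
    to_mat p q g \<rightarrow>\<^sup>*\<^bsub>with_proj (switch_digraph R C)\<^esub> to_mat p q g'"
  proof (induction rule: rtranclp_induct)
    case base
    have "to_mat p q g \<in> verts (with_proj (switch_digraph R C))"
      using g by (simp add: switch_digraph_def)
    then show ?case using g by (blast intro: reachable_refl)
  next
    case (step g1 g2)
    have sw: "positive_switch (to_mat p q g1) (to_mat p q g2)" "to_mat p q g2 \<in> matrix_class R C"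
      using rectangle_step_to_mat[OF R C step.hyps(2)] step.IH by blast+
    then have "to_mat p q g1 \<rightarrow>\<^bsub>with_proj (switch_digraph R C)\<^esub> to_mat p q g2"
      using step.IH by (simp add: switch_digraph_def)
    then show ?case using step.IH sw(2) by (blast intro: reachable_adj_trans)
  qed
  then show ?thesis by blast
qed

section \<open>Truncating the potential level by level\<close>

text \<open>Shows that capping the potential at any height leaves each entry at its initial or its
  final value. This is where the Lipschitz condition and the bound on the entries enter.\<close>

lemma corner_sum_min_cases:
  assumes lip: "\<And>i k i' k'. 0 \<le> i \<Longrightarrow> i < int m \<Longrightarrow> 0 \<le> k \<Longrightarrow> k < int n \<Longrightarrow>
      0 \<le> i' \<Longrightarrow> i' < int m \<Longrightarrow> 0 \<le> k' \<Longrightarrow> k' < int n \<Longrightarrow> \<bar>i' - i\<bar> \<le> 1 \<Longrightarrow> \<bar>k' - k\<bar> \<le> 1 \<Longrightarrow>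
      \<bar>t i' k' - t i k\<bar> \<le> 1"
    and out: "\<And>i k. \<not> (0 \<le> i \<and> i < int m \<and> 0 \<le> k \<and> k < int n) \<Longrightarrow> t i k = 0"
    and bd: "\<bar>corner_sum t a b\<bar> \<le> 1" and "0 \<le> s"
  shows "corner_sum (\<lambda>i k. min (t i k) s) a b \<in> {0, corner_sum t a b}"
proof -
  define w x y z where "w = t a b" and "x = t (a - 1) (b - 1)" and "y = t (a - 1) b" and "z = t a (b - 1)"
  have goal: "min w s + min x s - min y s - min z s \<in> {0, w + x - y - z} \<Longrightarrow> ?thesis"
    by (simp add: corner_sum_def w_def x_def y_def z_def)
  have bd: "\<bar>w + x - y - z\<bar> \<le> 1" using bd by (simp add: corner_sum_def w_def x_def y_def z_def)
  define r where "r i \<longleftrightarrow> 0 \<le> i \<and> i < int m" for i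
  define c where "c k \<longleftrightarrow> 0 \<le> k \<and> k < int n" for k
  have zero: "\<not> r a \<or> \<not> c b \<Longrightarrow> w = 0" "\<not> r (a - 1) \<or> \<not> c (b - 1) \<Longrightarrow> x = 0"
    "\<not> r (a - 1) \<or> \<not> c b \<Longrightarrow> y = 0" "\<not> r a \<or> \<not> c (b - 1) \<Longrightarrow> z = 0"
    using out by (auto simp: w_def x_def y_def z_def r_def c_def)
  have near: "\<bar>t i' k' - t i k\<bar> \<le> 1"
    if "r i" "c k" "r i'" "c k'" "\<bar>i' - i\<bar> \<le> 1" "\<bar>k' - k\<bar> \<le> 1" for i k i' k'
    using lip[of i k i' k'] that by (simp add: r_def c_def)
  have wy: "r a \<Longrightarrow> r (a - 1) \<Longrightarrow> c b \<Longrightarrow> \<bar>w - y\<bar> \<le> 1"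
    and zx: "r a \<Longrightarrow> r (a - 1) \<Longrightarrow> c (b - 1) \<Longrightarrow> \<bar>z - x\<bar> \<le> 1"
    and wz: "c b \<Longrightarrow> c (b - 1) \<Longrightarrow> r a \<Longrightarrow> \<bar>w - z\<bar> \<le> 1"
    and yx: "c b \<Longrightarrow> c (b - 1) \<Longrightarrow> r (a - 1) \<Longrightarrow> \<bar>y - x\<bar> \<le> 1"
    and wx: "r a \<Longrightarrow> r (a - 1) \<Longrightarrow> c b \<Longrightarrow> c (b - 1) \<Longrightarrow> \<bar>w - x\<bar> \<le> 1"
    and yz: "r a \<Longrightarrow> r (a - 1) \<Longrightarrow> c b \<Longrightarrow> c (b - 1) \<Longrightarrow> \<bar>y - z\<bar> \<le> 1"
    unfolding w_def x_def y_def z_def by (rule near; simp)+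
  show ?thesis
  proof (rule goal, cases "r a \<and> r (a - 1) \<and> c b \<and> c (b - 1)")
    case True
    then have "\<bar>w - y\<bar> \<le> 1" "\<bar>z - x\<bar> \<le> 1" "\<bar>w - z\<bar> \<le> 1" "\<bar>y - x\<bar> \<le> 1" "\<bar>w - x\<bar> \<le> 1" "\<bar>y - z\<bar> \<le> 1"
      using wy zx wz yx wx yz by blast+
    \<comment> \<open>The four values are \<open>lo\<close> or \<open>lo + 1\<close>, so an integer
      cap either flattens all of them or changes none.\<close>
    moreover define lo where "lo = min (min w x) (min y z)"
    ultimately have "w \<in> {lo, lo + 1}" "x \<in> {lo, lo + 1}" "y \<in> {lo, lo + 1}" "z \<in> {lo, lo + 1}"
      by (auto simp: min_def abs_if split: if_splits)
    moreover have "s \<le> lo \<or> lo + 1 \<le> s" by linarith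
    ultimately show "min w s + min x s - min y s - min z s \<in> {0, w + x - y - z}"
      by (auto simp: min_absorb1 min_absorb2)
  next
    case False
    \<comment> \<open>At the border two cells of opposite sign are missing, and the difference of
      the other two is bounded by the corner sum itself.\<close>
    have two: "min u s - min v s \<in> {0, u - v}" if "\<bar>u - v\<bar> \<le> 1" for u v
      using that by (auto simp: min_def)
    consider "w = 0" "z = 0" | "x = 0" "y = 0" | "w = 0" "y = 0" | "x = 0" "z = 0"
      using False zero by blast
    then show "min w s + min x s - min y s - min z s \<in> {0, w + x - y - z}"
    proof cases
      case 1
      then show ?thesis using two[of x y] bd \<open>0 \<le> s\<close> by simp
    next
      case 2
      then show ?thesis using two[of w z] bd \<open>0 \<le> s\<close> by simp
    next
      case 3
      then show ?thesis using two[of x z] bd \<open>0 \<le> s\<close> by simp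
    next
      case 4
      then show ?thesis using two[of w y] bd \<open>0 \<le> s\<close> by simp
    qed
  qed
qed

lemma edge_component_image:
  assumes "c \<in> S"
  defines "r \<equiv> {(c, d). c \<in> S \<and> d \<in> S \<and> share_edge c d}"
  shows "r\<^sup>* `` {c} \<in> edge_components S" "c \<in> r\<^sup>* `` {c}" "r\<^sup>* `` {c} \<subseteq> S"
    "\<And>x y. x \<in> r\<^sup>* `` {c} \<Longrightarrow> y \<in> S \<Longrightarrow> share_edge x y \<Longrightarrow> y \<in> r\<^sup>* `` {c}"
proof -
  show "r\<^sup>* `` {c} \<in> edge_components S"
    using assms by (simp add: edge_components_def quotientI)
  show "c \<in> r\<^sup>* `` {c}" by simp
  show sub: "r\<^sup>* `` {c} \<subseteq> S"
  proof
    fix d assume "d \<in> r\<^sup>* `` {c}"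
    then have "(c, d) \<in> r\<^sup>*" by simp
    then show "d \<in> S" by cases (use assms in auto)
  qed
  show "y \<in> r\<^sup>* `` {c}" if "x \<in> r\<^sup>* `` {c}" "y \<in> S" "share_edge x y" for x y
  proof -
    have "(x, y) \<in> r" using that sub by (auto simp: r_def)
    then show ?thesis using that(1) by (auto intro: rtrancl_into_rtrancl)
  qed
qed

text \<open>Embedding into the integers preserves the region of a component, so the hypothesis on
  polyominoes carries over.\<close>

lemma separable_map_int:
  assumes "finite S"
    and sc: "\<And>D. D \<in> edge_components S \<Longrightarrow> simply_connected (polyomino_region D)"
  shows "separable (map_prod int int ` S)"
proof (rule separable_if_components_simply_connected)
  show "finite (map_prod int int ` S)" using assms(1) by simp
  fix c assume "c \<in> map_prod int int ` S"
  then obtain c0 where c0: "c = map_prod int int c0" "c0 \<in> S" by (rule imageE)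
  define K where "K = {(c, d). c \<in> S \<and> d \<in> S \<and> share_edge c d}\<^sup>* `` {c0}"
  have K: "K \<in> edge_components S" "c0 \<in> K" "K \<subseteq> S"
    "\<And>x y. x \<in> K \<Longrightarrow> y \<in> S \<Longrightarrow> share_edge x y \<Longrightarrow> y \<in> K"
    unfolding K_def by (fact edge_component_image[OF c0(2)])+
  have adj: "share_edge x y" if "adj (map_prod int int x) (map_prod int int y)" for x y
    using that by (cases x; cases y) (simp add: adj_def share_edge_def, linarith)
  have "(\<Union>c\<in>map_prod int int ` K. int_cell c) = polyomino_region K"
    by (simp add: polyomino_region_def cell_region_def int_cell_def)
  then have "simply_connected (\<Union>c\<in>map_prod int int ` K. int_cell c)" using sc K(1) by simp
  then show "\<exists>K\<subseteq>map_prod int int ` S. c \<in> K \<and>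
      (\<forall>x\<in>K. \<forall>y\<in>map_prod int int ` S. adj x y \<longrightarrow> y \<in> K) \<and> simply_connected (\<Union>c\<in>K. int_cell c)"
  proof (intro exI[of _ "map_prod int int ` K"] conjI ballI impI)
    fix x y assume "x \<in> map_prod int int ` K" "y \<in> map_prod int int ` S" "adj x y"
    then obtain x0 y0 where "x0 \<in> K" "x = map_prod int int x0" "y0 \<in> S" "y = map_prod int int y0"
      by (elim imageE) (rule that)
    moreover from this have "y0 \<in> K" using K(4)[of x0 y0] adj[of x0 y0] \<open>adj x y\<close> by simp
    ultimately show "y \<in> map_prod int int ` K" by simp
  qed (use K(2,3) c0 in auto)
qed

theorem theorem3:
  fixes p q :: nat
    and R C :: "nat Matrix.vec"
    and A A' :: "int Matrix.mat"
    and T :: "nat Matrix.mat"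
  assumes "R \<in> carrier_vec p" and "C \<in> carrier_vec q"
    and "A \<in> matrix_class R C" and "A' \<in> matrix_class R C"
    and "T \<in> carrier_mat (p - 1) (q - 1)"
    and "A' - A = Matrix.mat p q (\<lambda>ab. \<Sum>i < p - 1. \<Sum>k < q - 1.
           int (T $$ (i, k)) * checkerboard_mat p q i (i + 1) k (k + 1) $$ ab)"
    and "\<forall>s \<ge> 1. \<forall>D \<in> edge_components (level_cells T s). simply_connected (polyomino_region D)"
    and "\<forall>i < p - 1. \<forall>i' < p - 1. \<forall>k < q - 1. \<forall>k' < q - 1.
           \<bar>int i' - int i\<bar> \<le> 1 \<and> \<bar>int k' - int k\<bar> \<le> 1 \<longrightarrow>
           \<bar>int (T $$ (i', k')) - int (T $$ (i, k))\<bar> \<le> 1"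
  shows "A \<rightarrow>\<^sup>*\<^bsub>with_proj (switch_digraph R C)\<^esub> A'"
proof -
  define m n where "m = p - 1" and "n = q - 1"
  define U where "U = {0..<int m} \<times> {0..<int n}"
  define t where "t = padded (\<lambda>c. int (T $$ c)) m n"
  define g g' where "g = padded (\<lambda>c. A $$ c) p q" and "g' = padded (\<lambda>c. A' $$ c) p q"
  have dims: "dim_vec R = p" "dim_vec C = q" "dim_row T = m" "dim_col T = n"
    using assms(1,2,5) by (auto simp: m_def n_def)
  have carr: "A \<in> carrier_mat p q" "A' \<in> carrier_mat p q"
    using assms(3,4) by (auto simp: matrix_class_def dims)
  have bin_padded: "zero_one (padded (\<lambda>c. B $$ c) p q)" if "B \<in> matrix_class R C" for B
    unfolding zero_one_def
  proof (intro allI)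
    fix a b
    have "B \<in> carrier_mat p q" "elements_mat B \<subseteq> {0, 1}"
      using that by (auto simp: matrix_class_def dims)
    then have "B $$ (i, k) \<in> {0, 1}" if "i < p" "k < q" for i k
      using that by (force simp: elements_mat_def)
    from this[of "nat a" "nat b"] show "padded (\<lambda>c. B $$ c) p q a b \<in> {0, 1}"
      by (auto simp: padded_def)
  qed
  have bin: "zero_one g" "zero_one g'" using bin_padded assms(3,4) by (auto simp: g_def g'_def)
  \<comment> \<open>Hypothesis (i) holds at all integer positions: outside the matrix both sides are
    0, as the grid has one row and one column less.\<close>
  have diff: "g' a b = g a b + corner_sum t a b" for a b
  proof (cases "0 \<le> a \<and> a < int p \<and> 0 \<le> b \<and> b < int q")
    case True
    define a0 b0 where "a0 = nat a" and "b0 = nat b"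
    have ab: "a = int a0" "b = int b0" "a0 < p" "b0 < q" using True by (auto simp: a0_def b0_def)
    have "(A' - A) $$ (a0, b0) = corner_sum t a b"
      unfolding assms(6) ab(1,2) t_def m_def n_def using ab(3,4) sum_checkerboard_mat[of a0 p b0 q] by simp
    moreover have "(A' - A) $$ (a0, b0) = A' $$ (a0, b0) - A $$ (a0, b0)"
      using carr ab(3,4) by simp
    ultimately show ?thesis using ab by (simp add: g_def g'_def padded_def)
  next
    case False
    then have "g a b = 0" "g' a b = 0" by (auto simp: g_def g'_def padded_def)
    moreover have "corner_sum t a b = 0"
      using False by (auto simp: corner_sum_def t_def padded_def m_def n_def)
    ultimately show ?thesis by simp
  qed
  have g01: "g a b \<in> {0, 1}" "g a b + corner_sum t a b \<in> {0, 1}" for a b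
    using bin diff by (auto simp: zero_one_def)
  have bd: "\<bar>corner_sum t a b\<bar> \<le> 1" for a b using g01[of a b] by auto
  define level where "level s = {(i, k). s \<le> t i k}" for s :: int
  \<comment> \<open>The restriction to \<open>1 \<le> s\<close> is essential: because of the zero
    padding, level 0 is the whole plane.\<close>
  have level_eq: "level (int s) = map_prod int int ` level_cells T s" if "1 \<le> s" for s
  proof -
    have "(i, k) \<in> level (int s) \<longleftrightarrow> (i, k) \<in> map_prod int int ` level_cells T s" for i k
    proof
      assume "(i, k) \<in> level (int s)"
      then have "(nat i, nat k) \<in> level_cells T s" "0 \<le> i" "0 \<le> k"
        using that by (auto simp: level_def t_def padded_def level_cells_def dims split: if_splits)
      then show "(i, k) \<in> map_prod int int ` level_cells T s"
        by (intro image_eqI[of _ _ "(nat i, nat k)"]) auto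
    qed (auto simp: level_def t_def padded_def level_cells_def dims)
    then show ?thesis by auto
  qed
  have fin: "finite (level_cells T s)" for s
    by (rule finite_subset[of _ "{..<m} \<times> {..<n}"]) (auto simp: level_cells_def dims)
  \<comment> \<open>Intermediate matrices, from \<open>g\<close> at height 0 to \<open>g'\<close> at
    a height above all entries of \<open>T\<close>.\<close>
  define h where "h s = (\<lambda>a b. g a b + corner_sum (\<lambda>i k. min (t i k) (int s)) a b)" for s
  have bin_h: "zero_one (h s)" for s
    unfolding zero_one_def h_def
  proof (intro allI)
    fix a b
    have "corner_sum (\<lambda>i k. min (t i k) (int s)) a b \<in> {0, corner_sum t a b}"
    proof (rule corner_sum_min_cases[where m = m and n = n])
      show "\<bar>t i' k' - t i k\<bar> \<le> 1"
        if "0 \<le> i" "i < int m" "0 \<le> k" "k < int n" "0 \<le> i'" "i' < int m" "0 \<le> k'" "k' < int n"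
          "\<bar>i' - i\<bar> \<le> 1" "\<bar>k' - k\<bar> \<le> 1" for i k i' k'
        using assms(8)[folded m_def n_def, rule_format, of "nat i" "nat i'" "nat k" "nat k'"] that
        by (simp add: t_def padded_def)
      show "t i k = 0" if "\<not> (0 \<le> i \<and> i < int m \<and> 0 \<le> k \<and> k < int n)" for i k
        using that by (auto simp: t_def padded_def)
    qed (use bd in simp_all)
    then show "g a b + corner_sum (\<lambda>i k. min (t i k) (int s)) a b \<in> {0, 1}"
      using g01[of a b] by auto
  qed
  \<comment> \<open>Raising the cap by one adds 1 exactly on the next superlevel set.\<close>
  have h_Suc: "h (Suc s) = bump (h s) (level (int (Suc s)))" for s
  proof -
    have "min (t i k) (int (Suc s)) =
        min (t i k) (int s) + of_bool ((i, k) \<in> level (int (Suc s)))" for i k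
      by (auto simp: level_def)
    then show ?thesis unfolding h_def bump_def corner_sum_def by (simp add: fun_eq_iff)
  qed
  have steps: "(rectangle_step U)\<^sup>*\<^sup>* (h 0) (h s)" for s
  proof (induction s)
    case (Suc s)
    have eq: "level (int (Suc s)) = map_prod int int ` level_cells T (Suc s)"
      by (rule level_eq) simp
    have "(rectangle_step U)\<^sup>*\<^sup>* (h s) (bump (h s) (level (int (Suc s))))"
    proof (rule rectangle_steps_bump)
      show "finite (level (int (Suc s)))" unfolding eq by (intro finite_imageI fin)
      show "separable (level (int (Suc s)))"
        unfolding eq by (rule separable_map_int[OF fin]) (use assms(7) in auto)
      show "level (int (Suc s)) \<subseteq> U"
        by (auto simp: level_def U_def t_def padded_def split: if_splits)
      show "zero_one (bump (h s) (level (int (Suc s))))" using bin_h h_Suc by metis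
    qed (rule bin_h)
    then show ?case using Suc.IH h_Suc by (metis rtranclp_trans)
  qed simp
  have "finite ((\<lambda>c. T $$ c) ` ({..<m} \<times> {..<n}))" by simp
  then obtain N where N: "\<And>c. c \<in> {..<m} \<times> {..<n} \<Longrightarrow> T $$ c \<le> N"
    unfolding finite_nat_set_iff_bounded_le by blast
  have "min (t i k) (int N) = t i k" for i k
    using N[of "(nat i, nat k)"] by (auto simp: t_def padded_def nat_less_iff intro!: min_absorb1)
  then have "h N = g'" using diff by (simp add: h_def fun_eq_iff)
  moreover have "min (t i k) (int 0) = 0" for i k by (simp add: t_def padded_def)
  then have "h 0 = g" by (simp add: h_def corner_sum_def)
  ultimately have "(rectangle_step U)\<^sup>*\<^sup>* g g'" using steps[of N] by simp
  moreover have "to_mat p q g = A" "to_mat p q g' = A'"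
    using to_mat_padded carr by (auto simp: g_def g'_def)
  ultimately show ?thesis
    using reachable_of_rectangle_steps[OF assms(1,2), of g g'] assms(3)
    by (simp add: U_def m_def n_def)
qed

end
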